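(* Let $D$ be an integral domain. (1) $D=\mathfrak{I}_0(D)=\mathfrak{I}_1(D)\subseteq \mathfrak{I}_2(D)\subseteq \mathfrak{I}_3(D)\subseteq\cdots$ and $\mathfrak{I}_k(D)\mathfrak{I}_l(D)\subseteq \mathfrak{I}_{k+l}(D)$ for all nonnegative integers $k,l$. (2) $D=0!_D=1!_D\supseteq 2!_D\supseteq 3!_D\supseteq\cdots$ and $(k+l)!_D\subseteq \left((k!_D)^{-1}(l!_D)^{-1}\right)^{-1}$ for all nonnegative integers $k,l$. (3) For any multiplicative subset $S$ of $D$, one has $S^{-1}\operatorname{Int}(D)=\operatorname{Int}(S^{-1}D)$ if and only if $S^{-1}\mathfrak{I}_n(D)=\mathfrak{I}_n(S^{-1}D)$ for every nonnegative integer $n$. (4) If $\mathfrak{p}$ is a prime ideal of $D$ that is not a $t$-maximal ideal of finite norm, then $\operatorname{Int}(D)_\mathfrak{p}=\operatorname{Int}(D_\mathfrak{p})=D_\mathfrak{p}[X]$ and $\mathfrak{I}_n(D)_\mathfrak{p}=\mathfrak{I}_n(D_\mathfrak{p})=D_\mathfrak{p}$ for every nonnegative integer $n$. (5) $\mathfrak{I}_n(D)$ is a $w$-ideal and $n!_D$ is a $v$-ideal for every nonnegative integer $n$. (6) If $\mathfrak{I}_n(D)$ is $t$-invertible, where $n$ is a nonnegative integer, then $\mathfrak{I}_n(D)$ is a $v$-ideal and $\mathfrak{I}_n(D)=(n!_D)^{-1}$. (7) Suppose that $\mathfrak{I}_k(D)$ is $t$-invertible for all $k\le n$. Then: (a)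 for any $f\in\operatorname{Int}_n(D)$, all of the coefficients of $f$ lie in $\mathfrak{I}_n(D)$; (b) $n!_D=(D[X]:_D\operatorname{Int}_n(D))$; (c) $(k+l)!_D\subseteq (k!_D\, l!_D)_t$ for all $k,l\le n$. (8) If $D$ is polynomially L-regular, then: (a) $S^{-1}\mathfrak{I}_n(D)=\mathfrak{I}_n(S^{-1}D)$ for every $n$ and every multiplicative subset $S$ of $D$; (b) if $\mathfrak{I}_n(D)$ is $t$-invertible, where $n$ is a nonnegative integer, then $n!_D D_\mathfrak{p}=n!_{D_\mathfrak{p}}$ for every $t$-maximal ideal $\mathfrak{p}$ of $D$, and $\mathfrak{I}_n(D_\mathfrak{p})$ is principal for every prime ideal $\mathfrak{p}$ of $D$; (c) if $\mathfrak{I}_n(D)$ is $t$-invertible for all $n$, then $\operatorname{Int}(D_\mathfrak{p})$ has a regular basis for every prime ideal $\mathfrak{p}$ of $D$, and the $D$-module $\operatorname{Int}(D)$ is locally free.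
   Context: Let $D$ be an integral domain with quotient field $K$. $\operatorname{Int}(D)=\{f\in K[X]: f(D)\subseteq D\}$ and $\operatorname{Int}_n(D)=\{f\in\operatorname{Int}(D):\deg f\le n\}$. The $n$th characteristic ideal $\mathfrak{I}_n(D)\subseteq K$ is the set of coefficients of $X^n$ of the polynomials in $\operatorname{Int}_n(D)$; it is a (nonzero) fractional ideal of $D$. The $n$th factorial ideal is $n!_D=\mathfrak{I}_n(D)^{-1}$. A regular basis of $\operatorname{Int}(D)$ is a $D$-module basis consisting of exactly one polynomial of each degree. $(D[X]:_D\operatorname{Int}_n(D))=\{r\in D: r\operatorname{Int}_n(D)\subseteq D[X]\}$. A fractional ideal of $D$ is a $D$-submodule $I$ of $K$ with $aI\subseteq D$ for some nonzero $a\in D$. For nonzero fractional ideals $I$: $I^{-1}=\{x\in K: xI\subseteq D\}$; $I_v=(I^{-1})^{-1}$; $I_t=\bigcup J_v$ over the nonzero finitely generated $J\subseteq I$; $I_w=\bigcup (I:_K J)$ over the ideals $J\subseteq D$ with $J_t=D$. For $*\in\{v,t,w\}$, $I$ is a $*$-ideal if $I_*=I$. $I$ is $t$-invertible if $(II^{-1})_t=D$. A $t$-maximal ideal of $D$ is an ideal maximal among the nonzero proper ideals of $D$ that are $t$-ideals. The norm of an ideal $\mathfrak{a}$ of $D$ is $N(\mathfrak{a})=|D/\mathfrak{a}|$. $D$ is polynomially L-regular if $S^{-1}\operatorname{Int}(D)=\operatorname{Int}(S^{-1}D)$ for every multiplicative subset $S$ of $D$ (with $0\notin S$). A $D$-module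 $M$ is locally free if $M_\mathfrak{p}$ is a free $D_\mathfrak{p}$-module for every prime ideal $\mathfrak{p}$ of $D$. *)

theory Defs
  imports Main "HOL-Computational_Algebra.Polynomial"
begin

text \<open>
  An integral domain is represented as a subring \<open>D\<close> of a field type \<open>'k\<close> that plays the role
  of the quotient field \<open>K\<close>. All localizations \<open>S\<^sup>-\<^sup>1D\<close> are then again
  subrings of \<open>'k\<close> with quotient field \<open>'k\<close>, so every notion below is stated for an arbitrary
  such subring. Ideals and fractional ideals are subsets of \<open>'k\<close>.
\<close>

definition is_subring :: "'k::field set \<Rightarrow> bool" where
  "is_subring D \<longleftrightarrow> 0 \<in> D \<and> 1 \<in> D \<and>
     (\<forall>x\<in>D. \<forall>y\<in>D. x + y \<in> D \<and> x * y \<in> D) \<and> (\<forall>x\<in>D. - x \<in> D)"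

definition domain_with_quotient_field :: "'k::field set \<Rightarrow> bool" where
  "domain_with_quotient_field D \<longleftrightarrow>
     is_subring D \<and> (\<forall>x. \<exists>a\<in>D. \<exists>b\<in>D. b \<noteq> 0 \<and> x = a / b)"

definition submodule :: "'k::field set \<Rightarrow> 'k set \<Rightarrow> bool" where
  "submodule D I \<longleftrightarrow> 0 \<in> I \<and> (\<forall>x\<in>I. \<forall>y\<in>I. x + y \<in> I) \<and> (\<forall>r\<in>D. \<forall>x\<in>I. r * x \<in> I)"

definition ideal_of :: "'k::field set \<Rightarrow> 'k set \<Rightarrow> bool" where
  "ideal_of D I \<longleftrightarrow> submodule D I \<and> I \<subseteq> D"

definition prime_ideal :: "'k::field set \<Rightarrow> 'k set \<Rightarrow> bool" where
  "prime_ideal D P \<longleftrightarrow> ideal_of D P \<and> P \<noteq> D \<and>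
     (\<forall>a\<in>D. \<forall>b\<in>D. a * b \<in> P \<longrightarrow> a \<in> P \<or> b \<in> P)"

definition nonzero_fractional_ideal :: "'k::field set \<Rightarrow> 'k set \<Rightarrow> bool" where
  "nonzero_fractional_ideal D I \<longleftrightarrow> submodule D I \<and> I \<noteq> {0} \<and>
     (\<exists>a\<in>D. a \<noteq> 0 \<and> (\<forall>x\<in>I. a * x \<in> D))"

definition finitely_generated :: "'k::field set \<Rightarrow> 'k set \<Rightarrow> bool" where
  "finitely_generated D J \<longleftrightarrow> (\<exists>F. finite F \<and> J = submodule D hull F)"

definition is_principal :: "'k::field set \<Rightarrow> 'k set \<Rightarrow> bool" where
  "is_principal D I \<longleftrightarrow> (\<exists>a. I = {r * a | r. r \<in> D})"

definition ideal_prod :: "'k::field set \<Rightarrow> 'k set \<Rightarrow> 'k set \<Rightarrow> 'k set" where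
  "ideal_prod D I J = submodule D hull {x * y | x y. x \<in> I \<and> y \<in> J}"

definition colon :: "'k::field set \<Rightarrow> 'k set \<Rightarrow> 'k set" where
  "colon I J = {x. \<forall>y\<in>J. x * y \<in> I}"

definition finite_norm :: "'k::field set \<Rightarrow> 'k set \<Rightarrow> bool" where
  "finite_norm D I \<longleftrightarrow> finite (D // {(x, y). x \<in> D \<and> y \<in> D \<and> x - y \<in> I})"

abbreviation inv_ideal :: "'k::field set \<Rightarrow> 'k set \<Rightarrow> 'k set" where
  "inv_ideal D I \<equiv> colon D I"

definition v_op :: "'k::field set \<Rightarrow> 'k set \<Rightarrow> 'k set" where
  "v_op D I = inv_ideal D (inv_ideal D I)"

definition t_op :: "'k::field set \<Rightarrow> 'k set \<Rightarrow> 'k set" where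
  "t_op D I = \<Union>{v_op D J | J. finitely_generated D J \<and> J \<noteq> {0} \<and> J \<subseteq> I}"

definition w_op :: "'k::field set \<Rightarrow> 'k set \<Rightarrow> 'k set" where
  "w_op D I = \<Union>{colon I J | J. ideal_of D J \<and> J \<noteq> {0} \<and> t_op D J = D}"

text \<open>\<open>star_ideal v_op D I\<close> says that \<open>I\<close> is a \<open>v\<close>-ideal of \<open>D\<close>, likewise for \<open>t\<close> and \<open>w\<close>.\<close>

definition star_ideal ::
    "('k::field set \<Rightarrow> 'k set \<Rightarrow> 'k set) \<Rightarrow> 'k set \<Rightarrow> 'k set \<Rightarrow> bool" where
  "star_ideal star D I \<longleftrightarrow> nonzero_fractional_ideal D I \<and> star D I = I"

definition t_invertible :: "'k::field set \<Rightarrow> 'k set \<Rightarrow> bool" where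
  "t_invertible D I \<longleftrightarrow> nonzero_fractional_ideal D I \<and>
     t_op D (ideal_prod D I (inv_ideal D I)) = D"

definition proper_t_ideal :: "'k::field set \<Rightarrow> 'k set \<Rightarrow> bool" where
  "proper_t_ideal D I \<longleftrightarrow> ideal_of D I \<and> I \<noteq> {0} \<and> I \<noteq> D \<and> star_ideal t_op D I"

definition t_maximal :: "'k::field set \<Rightarrow> 'k set \<Rightarrow> bool" where
  "t_maximal D P \<longleftrightarrow> proper_t_ideal D P \<and> (\<forall>I. proper_t_ideal D I \<and> P \<subseteq> I \<longrightarrow> I = P)"

definition mult_subset :: "'k::field set \<Rightarrow> 'k set \<Rightarrow> bool" where
  "mult_subset D S \<longleftrightarrow> S \<subseteq> D \<and> 1 \<in> S \<and> 0 \<notin> S \<and> (\<forall>s\<in>S. \<forall>t\<in>S. s * t \<in> S)"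

text \<open>
  Submodules of the \<open>K\<close>-vector spaces \<open>K\<close> and \<open>K[X]\<close> are torsion-free, so their localizations
  are identified with submodules of \<open>K\<close> and \<open>K[X]\<close>.
\<close>

definition localize :: "'k::field set \<Rightarrow> 'k set \<Rightarrow> 'k set" where
  "localize S M = {x / s | x s. x \<in> M \<and> s \<in> S}"

definition localize_poly :: "'k::field set \<Rightarrow> 'k poly set \<Rightarrow> 'k poly set" where
  "localize_poly S M = {smult (1 / s) f | f s. f \<in> M \<and> s \<in> S}"

definition polys_over :: "'k::field set \<Rightarrow> 'k poly set" where
  "polys_over D = {f. \<forall>i. coeff f i \<in> D}"

definition Int_poly :: "'k::field set \<Rightarrow> 'k poly set" where
  "Int_poly D = {f. \<forall>x\<in>D. poly f x \<in> D}"

definition Int_poly_le :: "nat \<Rightarrow> 'k::field set \<Rightarrow> 'k poly set" where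
  "Int_poly_le n D = {f \<in> Int_poly D. degree f \<le> n}"

definition char_ideal :: "nat \<Rightarrow> 'k::field set \<Rightarrow> 'k set" where
  "char_ideal n D = {coeff f n | f. f \<in> Int_poly_le n D}"

definition fact_ideal :: "nat \<Rightarrow> 'k::field set \<Rightarrow> 'k set" where
  "fact_ideal n D = inv_ideal D (char_ideal n D)"

definition conductor :: "'k::field set \<Rightarrow> 'k poly set \<Rightarrow> 'k poly set \<Rightarrow> 'k set" where
  "conductor D N M = {r \<in> D. \<forall>f\<in>M. smult r f \<in> N}"

definition polynomially_L_regular :: "'k::field set \<Rightarrow> bool" where
  "polynomially_L_regular D \<longleftrightarrow>
     (\<forall>S. mult_subset D S \<longrightarrow> localize_poly S (Int_poly D) = Int_poly (localize S D))"

definition module_basis :: "'k::field set \<Rightarrow> 'k poly set \<Rightarrow> 'k poly set \<Rightarrow> bool" where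
  "module_basis D M B \<longleftrightarrow>
     M = {\<Sum>b\<in>F. smult (c b) b | F c. finite F \<and> F \<subseteq> B \<and> c ` F \<subseteq> D} \<and>
     (\<forall>F c. finite F \<and> F \<subseteq> B \<and> c ` F \<subseteq> D \<and> (\<Sum>b\<in>F. smult (c b) b) = 0 \<longrightarrow> (\<forall>b\<in>F. c b = 0))"

definition free_module :: "'k::field set \<Rightarrow> 'k poly set \<Rightarrow> bool" where
  "free_module D M \<longleftrightarrow> (\<exists>B. module_basis D M B)"

definition locally_free :: "'k::field set \<Rightarrow> 'k poly set \<Rightarrow> bool" where
  "locally_free D M \<longleftrightarrow>
     (\<forall>P. prime_ideal D P \<longrightarrow> free_module (localize (D - P) D) (localize_poly (D - P) M))"

definition has_regular_basis :: "'k::field set \<Rightarrow> bool" where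
  "has_regular_basis D \<longleftrightarrow>
     (\<exists>B. module_basis D (Int_poly D) B \<and> (\<forall>n. \<exists>!f. f \<in> B \<and> degree f = n))"

end

theory Submission
  imports Defs
begin

text \<open>
  Two devices carry the proof. First, if \<open>f\<close> has degree at most \<open>n\<close> and maps \<open>x\<^sub>0, \<dots>, x\<^sub>n\<close> into \<open>D\<close>,
  Lagrange interpolation writes \<open>c \<Delta>(x\<^sub>0, \<dots>, x\<^sub>n)\<close>, for every coefficient \<open>c\<close> of \<open>f\<close>, as a
  \<open>D\<close>-combination of Vandermonde products \<open>\<Delta>\<close> of \<open>n\<close> points. At a prime \<open>P\<close> of infinite norm some
  \<open>\<Delta>\<close> is a unit, so integer-valued polynomials have coefficients in \<open>D\<^sub>P\<close>. If \<open>P\<close> has finite norm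
  but is not t-maximal, it contains a finite set \<open>F\<close> with \<open>F\<^sup>-\<^sup>1 = D\<close>, and the points
  \<open>1, b, b\<^sup>2, \<dots>\<close> with \<open>b \<in> F\<close> give \<open>c b\<^sup>N \<in> D\<^sub>P\<close>, whence \<open>c \<in> D\<^sub>P\<close>. This triviality at primes that
  are not t-maximal also makes \<open>I\<^sub>n\<close> a w-ideal.

  Second, let \<open>V\<^sub>n\<close> be the set of Vandermonde products of \<open>n\<close> points. Every coefficient \<open>c\<close> of an \<open>f\<close> as
  above satisfies \<open>c V\<^bsub>n+1\<^esub> \<subseteq> (V\<^sub>n)\<close>, and conversely \<open>V\<^bsub>n+1\<^esub>\<^sup>-\<^sup>1 V\<^sub>n \<subseteq> I\<^sub>n\<close>, because \<open>d \<Delta>(x\<^sub>1, \<dots>, x\<^sub>n, X)\<close> is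
  integer-valued for \<open>d \<in> V\<^bsub>n+1\<^esub>\<^sup>-\<^sup>1\<close>. If \<open>I\<^sub>0, \<dots>, I\<^sub>n\<close> are t-invertible, induction shows that \<open>V\<^bsub>n+1\<^esub>\<close>
  is v-invertible, so that \<open>c\<close> lies in the v-closure of \<open>I\<^sub>n\<close>, which is \<open>I\<^sub>n\<close>.
\<close>

section \<open>Subrings, colon ideals and localizations\<close>

locale subring_set =
  fixes D :: "'k::field set"
  assumes subring: "is_subring D"
begin

lemma zero_mem [simp]: "0 \<in> D" and one_mem [simp]: "1 \<in> D"
  using subring by (auto simp: is_subring_def)

lemma add_mem: "x \<in> D \<Longrightarrow> y \<in> D \<Longrightarrow> x + y \<in> D"
  and mult_mem: "x \<in> D \<Longrightarrow> y \<in> D \<Longrightarrow> x * y \<in> D"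
  and uminus_mem: "x \<in> D \<Longrightarrow> - x \<in> D"
  using subring by (auto simp: is_subring_def)

lemma diff_mem: "x \<in> D \<Longrightarrow> y \<in> D \<Longrightarrow> x - y \<in> D"
  using add_mem[of x "- y"] uminus_mem[of y] by simp

lemma uminus_mem_iff: "- x \<in> D \<longleftrightarrow> x \<in> D"
  using uminus_mem[of x] uminus_mem[of "- x"] by auto

lemma power_mem: "x \<in> D \<Longrightarrow> x ^ n \<in> D"
  by (induction n) (auto intro: mult_mem)

lemma sum_mem: "(\<And>i. i \<in> A \<Longrightarrow> g i \<in> D) \<Longrightarrow> sum g A \<in> D"
  by (induction A rule: infinite_finite_induct) (auto intro: add_mem)

lemma prod_list_mem: "set xs \<subseteq> D \<Longrightarrow> prod_list xs \<in> D"
  by (induction xs) (auto intro: mult_mem)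

lemma poly_mem: "f \<in> polys_over D \<Longrightarrow> x \<in> D \<Longrightarrow> poly f x \<in> D"
  unfolding poly_altdef polys_over_def by (auto intro!: sum_mem mult_mem power_mem)

lemma polys_over_subset_Int_poly: "polys_over D \<subseteq> Int_poly D"
  by (auto simp: Int_poly_def poly_mem)

lemma submodule_self: "submodule D D"
  by (auto simp: submodule_def intro: add_mem mult_mem)

lemma submodule_hull: "submodule D (submodule D hull F)"
proof (rule hull_in)
  fix T assume "\<forall>t\<in>T. submodule D t"
  then show "submodule D (\<Inter> T)" by (auto simp: submodule_def)
qed

lemma submodule_colon: "submodule D I \<Longrightarrow> submodule D (colon I J)"
  unfolding submodule_def colon_def
  by (auto simp: distrib_right mult.assoc)

lemma submodule_diff:
  assumes "submodule D I" "x \<in> I" "y \<in> I" shows "x - y \<in> I"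
proof -
  have "- 1 * y \<in> I" using assms uminus_mem[OF one_mem] unfolding submodule_def by blast
  then have "x + - 1 * y \<in> I" using assms unfolding submodule_def by blast
  then show ?thesis by simp
qed

text \<open>For fixed \<open>x\<close>, the elements that \<open>x\<close> multiplies into
  \<open>I\<close> form a submodule, so generators suffice. Inverses and v-closures can thus be
  computed on generating sets.\<close>

lemma colon_hull:
  assumes "submodule D I" shows "colon I (submodule D hull F) = colon I F"
proof
  show "colon I (submodule D hull F) \<subseteq> colon I F"
    using hull_subset[of F "submodule D"] by (auto simp: colon_def)
  show "colon I F \<subseteq> colon I (submodule D hull F)"
  proof
    fix x assume x: "x \<in> colon I F"
    have "submodule D {y. x * y \<in> I}"
      using assms unfolding submodule_def by (auto simp: distrib_left mult.left_commute)
    moreover have "F \<subseteq> {y. x * y \<in> I}" using x by (auto simp: colon_def)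
    ultimately have "submodule D hull F \<subseteq> {y. x * y \<in> I}" by (rule hull_minimal[rotated])
    then show "x \<in> colon I (submodule D hull F)" by (auto simp: colon_def)
  qed
qed

lemma submodule_ideal_prod: "submodule D (ideal_prod D I J)"
  unfolding ideal_prod_def by (rule submodule_hull)

lemma ideal_prod_mem: "x \<in> I \<Longrightarrow> y \<in> J \<Longrightarrow> x * y \<in> ideal_prod D I J"
  unfolding ideal_prod_def by (rule hull_inc) blast

lemma ideal_prod_subset:
  "submodule D M \<Longrightarrow> (\<And>x y. x \<in> I \<Longrightarrow> y \<in> J \<Longrightarrow> x * y \<in> M) \<Longrightarrow> ideal_prod D I J \<subseteq> M"
  unfolding ideal_prod_def by (rule hull_minimal) auto

lemma subset_v_op: "I \<subseteq> v_op D I"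
  unfolding v_op_def colon_def by (auto simp: mult.commute)

lemma v_op_hull: "v_op D (submodule D hull F) = v_op D F"
  unfolding v_op_def colon_hull[OF submodule_self] ..

lemma submodule_v_op: "submodule D (v_op D I)"
  unfolding v_op_def by (intro submodule_colon submodule_self)

lemma v_op_subset:
  assumes "I \<subseteq> D" shows "v_op D I \<subseteq> D"
proof
  fix x assume "x \<in> v_op D I"
  moreover have "1 \<in> inv_ideal D I" using assms by (auto simp: colon_def)
  ultimately have "x * 1 \<in> D" unfolding v_op_def colon_def by blast
  then show "x \<in> D" by simp
qed

text \<open>Colon ideals reverse inclusions, so \<open>I \<subseteq> v_op D I\<close> gives the
  nontrivial half.\<close>

lemma v_op_inv_ideal: "v_op D (inv_ideal D I) = inv_ideal D I"
proof
  show "v_op D (inv_ideal D I) \<subseteq> inv_ideal D I"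
    using subset_v_op[of I] unfolding v_op_def by (auto simp: colon_def)
qed (rule subset_v_op)

end

section \<open>Localization at a multiplicative subset\<close>

lemma mem_localize_iff: "0 \<notin> S \<Longrightarrow> x \<in> localize S M \<longleftrightarrow> (\<exists>s\<in>S. s * x \<in> M)"
proof
  assume "0 \<notin> S" "\<exists>s\<in>S. s * x \<in> M"
  then obtain s where "s \<in> S" "s * x \<in> M" "s \<noteq> 0" by blast
  then show "x \<in> localize S M" unfolding localize_def
    by (intro CollectI exI[of _ "s * x"] exI[of _ s]) auto
qed (force simp: localize_def)

lemma mem_localize_poly_iff:
  "0 \<notin> S \<Longrightarrow> f \<in> localize_poly S M \<longleftrightarrow> (\<exists>s\<in>S. smult s f \<in> M)"
proof
  assume "0 \<notin> S" "\<exists>s\<in>S. smult s f \<in> M"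
  then obtain s where "s \<in> S" "smult s f \<in> M" "s \<noteq> 0" by blast
  then show "f \<in> localize_poly S M" unfolding localize_poly_def
    by (intro CollectI exI[of _ "smult s f"] exI[of _ s]) auto
next
  assume "0 \<notin> S" "f \<in> localize_poly S M"
  then obtain g s where "g \<in> M" "s \<in> S" "f = smult (1 / s) g" "s \<noteq> 0"
    by (auto simp: localize_poly_def)
  then show "\<exists>s\<in>S. smult s f \<in> M" by (auto intro!: bexI[of _ s])
qed

lemma Int_poly_leI: "f \<in> Int_poly D \<Longrightarrow> degree f \<le> n \<Longrightarrow> coeff f n \<in> char_ideal n D"
  by (auto simp: char_ideal_def Int_poly_le_def)

lemma char_idealE:
  assumes "c \<in> char_ideal n D"
  obtains f where "f \<in> Int_poly D" "degree f \<le> n" "coeff f n = c"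
  using assms by (auto simp: char_ideal_def Int_poly_le_def)

locale localized = subring_set D for D :: "'k::field set" +
  fixes S :: "'k set"
  assumes mult_subset: "mult_subset D S"
begin

lemma S_subset: "S \<subseteq> D" and one_S [simp]: "1 \<in> S" and zero_S: "0 \<notin> S"
  and mult_S: "s \<in> S \<Longrightarrow> t \<in> S \<Longrightarrow> s * t \<in> S"
  using mult_subset by (auto simp: mult_subset_def)

lemma S_mem: "s \<in> S \<Longrightarrow> s \<in> D" using S_subset by blast

lemmas loc_iff = mem_localize_iff[OF zero_S]
lemmas loc_poly_iff = mem_localize_poly_iff[OF zero_S]

lemma finite_common_denominator:
  assumes "finite A" "\<And>a. a \<in> A \<Longrightarrow> g a \<in> localize S M" "submodule D M"
  shows "\<exists>s\<in>S. \<forall>a\<in>A. s * g a \<in> M"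
  using assms(1,2)
proof (induction A)
  case empty
  show ?case using one_S by blast
next
  case (insert a A)
  then obtain s where s: "s \<in> S" "\<forall>a\<in>A. s * g a \<in> M" by auto
  obtain t where t: "t \<in> S" "t * g a \<in> M" using insert.prems[of a] loc_iff by blast
  have M: "\<And>r x. r \<in> D \<Longrightarrow> x \<in> M \<Longrightarrow> r * x \<in> M" using assms(3) by (auto simp: submodule_def)
  have "s * t * g b \<in> M" if "b \<in> insert a A" for b
    using that M[of t "s * g b"] M[of s "t * g b"] s t S_mem by (auto simp: ac_simps)
  then show ?case using mult_S[OF s(1) t(1)] by blast
qed

lemma loc_subset: "M \<subseteq> localize S M"
  unfolding subset_iff loc_iff by (auto intro!: bexI[of _ 1])

lemma subring_localize: "is_subring (localize S D)"
  unfolding is_subring_def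
proof (intro conjI ballI)
  show "0 \<in> localize S D" "1 \<in> localize S D" using loc_subset[of D] by auto
next
  fix x y assume "x \<in> localize S D" "y \<in> localize S D"
  then obtain s t where s: "s \<in> S" "s * x \<in> D" and t: "t \<in> S" "t * y \<in> D" by (auto simp: loc_iff)
  have "t * (s * x) + s * (t * y) \<in> D" "(s * x) * (t * y) \<in> D"
    using s t S_mem by (auto intro!: add_mem mult_mem)
  then have "s * t * (x + y) \<in> D" "s * t * (x * y) \<in> D" by (auto simp: algebra_simps)
  then show "x + y \<in> localize S D" "x * y \<in> localize S D"
    using mult_S[OF s(1) t(1)] by (auto simp: loc_iff)
next
  fix x assume "x \<in> localize S D"
  then show "- x \<in> localize S D" using uminus_mem by (fastforce simp: loc_iff)
qed

sublocale L: subring_set "localize S D"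
  by standard (rule subring_localize)

lemma inverse_S: "s \<in> S \<Longrightarrow> inverse s \<in> localize S D"
  unfolding loc_iff by (rule bexI[of _ s]) (metis one_mem right_inverse zero_S)

lemma cancel_S: "s \<in> S \<Longrightarrow> s * x \<in> localize S D \<Longrightarrow> x \<in> localize S D"
  using L.mult_mem[OF inverse_S, of s "s * x"] zero_S
  by (cases "s = 0") (auto simp: mult.assoc[symmetric])

text \<open>The polynomial \<open>f(sX) - s\<^sup>n f(X)\<close> has smaller degree than \<open>f\<close>.\<close>

lemma Int_poly_subset_localize: "Int_poly D \<subseteq> Int_poly (localize S D)"
proof
  fix f assume "f \<in> Int_poly D"
  then show "f \<in> Int_poly (localize S D)"
  proof (induction "degree f" arbitrary: f rule: less_induct)
    case less
    have f: "\<And>x. x \<in> D \<Longrightarrow> poly f x \<in> D" using less.prems by (auto simp: Int_poly_def)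
    show ?case
    proof (cases "degree f = 0")
      case True
      then obtain c where c: "f = [:c:]" by (rule degree_eq_zeroE)
      then show ?thesis using f[of 0] loc_subset[of D] by (auto simp: Int_poly_def)
    next
      case False
      define n where "n = degree f"
      have "poly f y \<in> localize S D" if y: "y \<in> localize S D" for y
      proof -
        obtain s where s: "s \<in> S" "s * y \<in> D" using y by (auto simp: loc_iff)
        define g where "g = pcompose f [:0, s:] - smult (s ^ n) f"
        have g: "poly g x = poly f (s * x) - s ^ n * poly f x" for x
          by (simp add: g_def poly_pcompose mult.commute)
        have "degree (pcompose f [:0, s:]) \<le> n"
          using degree_pcompose_le[of f "[:0, s:]"] unfolding n_def
          by (cases "s = 0") auto
        then have "degree g \<le> n"
          unfolding g_def by (intro degree_diff_le) (auto simp: n_def degree_smult_le)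
        moreover have "coeff g n = 0"
          using coeff_pcompose_linear[of f s n] by (simp add: g_def)
        ultimately have "degree g < n"
          using False by (metis n_def eq_zero_or_degree_less neq0_conv degree_0 bot_nat_0.not_eq_extremum)
        moreover have "g \<in> Int_poly D"
          unfolding Int_poly_def mem_Collect_eq g
          using s S_mem f by (auto intro!: diff_mem mult_mem power_mem)
        ultimately have "g \<in> Int_poly (localize S D)" using less.hyps n_def by blast
        \<comment> \<open>The induction hypothesis controls \<open>g\<close> at \<open>y\<close>,
          and \<open>f\<close> is integer-valued at \<open>s * y \<in> D\<close>. So
          \<open>s ^ n * poly f y\<close> lies in the localization, where \<open>s ^ n\<close> is a
          unit.\<close>
        then have "poly f (s * y) - s ^ n * poly f y \<in> localize S D"
          using y g by (auto simp: Int_poly_def)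
        moreover have "poly f (s * y) \<in> localize S D" using f s loc_subset[of D] by blast
        ultimately have "s ^ n * poly f y \<in> localize S D"
          using L.diff_mem by fastforce
        moreover have "s ^ n \<in> S" by (induction n) (auto intro: mult_S s)
        ultimately show ?thesis using cancel_S by blast
      qed
      then show ?thesis by (auto simp: Int_poly_def)
    qed
  qed
qed

lemma loc_Int_poly_subset: "localize_poly S (Int_poly D) \<subseteq> Int_poly (localize S D)"
proof
  fix f assume "f \<in> localize_poly S (Int_poly D)"
  then obtain s where s: "s \<in> S" "smult s f \<in> Int_poly D" by (auto simp: loc_poly_iff)
  then have "smult s f \<in> Int_poly (localize S D)" using Int_poly_subset_localize by blast
  then show "f \<in> Int_poly (localize S D)" using cancel_S s by (auto simp: Int_poly_def)
qed

lemma loc_Int_poly_add: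
  assumes "f \<in> localize_poly S (Int_poly D)" "g \<in> localize_poly S (Int_poly D)"
  shows "f + g \<in> localize_poly S (Int_poly D)"
proof -
  obtain s t where s: "s \<in> S" "smult s f \<in> Int_poly D" and t: "t \<in> S" "smult t g \<in> Int_poly D"
    using assms by (auto simp: loc_poly_iff)
  have "s * t * (poly f x + poly g x) \<in> D" if "x \<in> D" for x
  proof -
    have "t * (s * poly f x) + s * (t * poly g x) \<in> D"
      using s t that S_mem by (intro add_mem mult_mem[of t "_ * _"] mult_mem[of s "_ * _"]) (auto simp: Int_poly_def)
    then show ?thesis by (simp add: algebra_simps)
  qed
  then have "smult (s * t) (f + g) \<in> Int_poly D" by (simp add: Int_poly_def)
  then show ?thesis using mult_S s t loc_poly_iff by blast
qed

lemma localize_char_ideal: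
  assumes "localize_poly S (Int_poly D) = Int_poly (localize S D)"
  shows "localize S (char_ideal n D) = char_ideal n (localize S D)"
proof
  show "localize S (char_ideal n D) \<subseteq> char_ideal n (localize S D)"
  proof
    fix c assume "c \<in> localize S (char_ideal n D)"
    then obtain s f where s: "s \<in> S" and f: "f \<in> Int_poly D" "degree f \<le> n" "coeff f n = s * c"
      unfolding loc_iff by (metis char_idealE)
    have s0: "s \<noteq> 0" using s zero_S by blast
    have "smult (inverse s) f \<in> Int_poly (localize S D)"
      using f(1) s s0 assms unfolding assms[symmetric] loc_poly_iff by (auto intro!: bexI[of _ s])
    moreover have "degree (smult (inverse s) f) \<le> n" using f(2) by simp
    ultimately have "coeff (smult (inverse s) f) n \<in> char_ideal n (localize S D)"
      by (rule Int_poly_leI)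
    then show "c \<in> char_ideal n (localize S D)" using f(3) s0 by (simp add: mult.assoc[symmetric])
  qed
  show "char_ideal n (localize S D) \<subseteq> localize S (char_ideal n D)"
  proof
    fix c assume "c \<in> char_ideal n (localize S D)"
    then obtain f where f: "f \<in> Int_poly (localize S D)" "degree f \<le> n" "coeff f n = c"
      by (rule char_idealE)
    then obtain s where s: "s \<in> S" "smult s f \<in> Int_poly D"
      unfolding assms[symmetric] loc_poly_iff by blast
    have "coeff (smult s f) n \<in> char_ideal n D"
      by (rule Int_poly_leI[OF s(2)]) (use f degree_smult_le[of s f] in simp)
    then show "c \<in> localize S (char_ideal n D)" using s f by (auto simp: loc_iff)
  qed
qed

text \<open>Induction on the degree: the hypothesis supplies \<open>h\<close> in the localization of
  \<open>Int_poly D\<close> with the same leading coefficient as \<open>f\<close>, and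
  \<open>f - h\<close> is zero or of smaller degree.\<close>

lemma localize_Int_poly:
  assumes "\<And>n. localize S (char_ideal n D) = char_ideal n (localize S D)"
  shows "localize_poly S (Int_poly D) = Int_poly (localize S D)"
proof
  show "Int_poly (localize S D) \<subseteq> localize_poly S (Int_poly D)"
  proof
    fix f assume "f \<in> Int_poly (localize S D)"
    then show "f \<in> localize_poly S (Int_poly D)"
    proof (induction "degree f" arbitrary: f rule: less_induct)
      case less
      define n where "n = degree f"
      have "coeff f n \<in> localize S (char_ideal n D)"
        unfolding assms by (rule Int_poly_leI[OF less.prems]) (simp add: n_def)
      then obtain s g where s: "s \<in> S" and g: "g \<in> Int_poly D" "degree g \<le> n" "coeff g n = s * coeff f n"
        unfolding loc_iff by (metis char_idealE)
      have s0: "s \<noteq> 0" using s zero_S by blast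
      define h where "h = smult (inverse s) g"
      have h: "h \<in> localize_poly S (Int_poly D)"
        unfolding loc_poly_iff using s g s0 by (auto intro!: bexI[of _ s] simp: h_def)
      then have "h \<in> Int_poly (localize S D)" using loc_Int_poly_subset by blast
      then have fh: "f - h \<in> Int_poly (localize S D)"
        using less.prems by (auto simp: Int_poly_def intro: L.diff_mem)
      have "degree (f - h) \<le> n"
        by (rule degree_diff_le) (use g in \<open>auto simp: n_def h_def\<close>)
      moreover have "coeff (f - h) n = 0" using g s0 by (simp add: h_def)
      ultimately have "f - h = 0 \<or> degree (f - h) < n" using eq_zero_or_degree_less by blast
      then have "f - h \<in> localize_poly S (Int_poly D)"
      proof
        assume "f - h = 0"
        then show ?thesis using one_S unfolding loc_poly_iff Int_poly_def by (intro bexI[of _ 1]) auto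
      qed (use less.hyps fh n_def in blast)
      from loc_Int_poly_add[OF this h] show ?case by simp
    qed
  qed
qed (rule loc_Int_poly_subset)

end

section \<open>Vandermonde products and Lagrange interpolation\<close>

fun vand :: "'a::comm_ring_1 list \<Rightarrow> 'a" where
  "vand [] = 1"
| "vand (x # xs) = (\<Prod>y\<leftarrow>xs. x - y) * vand xs"

lemma prod_list_map_remove1:
  fixes g :: "'b \<Rightarrow> 'a::comm_monoid_mult"
  shows "x \<in> set xs \<Longrightarrow> prod_list (map g xs) = g x * prod_list (map g (remove1 x xs))"
  by (induction xs) (auto simp: ac_simps)

text \<open>Moving an entry to the front of the list costs only a sign. The sign stays unspecified
  because \<open>D\<close> is closed under negation.\<close>

lemma vand_remove1:
  assumes "x \<in> set xs"
  shows "\<exists>e\<in>{1, -1}. vand xs = e * (\<Prod>y\<leftarrow>remove1 x xs. x - y) * vand (remove1 x xs)"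
  using assms
proof (induction xs)
  case (Cons a xs)
  show ?case
  proof (cases "a = x")
    case False
    then have x: "x \<in> set xs" using Cons.prems by simp
    then obtain e where e: "e \<in> {1, -1}"
      "vand xs = e * (\<Prod>y\<leftarrow>remove1 x xs. x - y) * vand (remove1 x xs)"
      using Cons.IH by blast
    have "vand (a # xs) = - e * (\<Prod>y\<leftarrow>remove1 x (a # xs). x - y) * vand (remove1 x (a # xs))"
    proof -
      have "(\<Prod>y\<leftarrow>xs. a - y) = (a - x) * (\<Prod>y\<leftarrow>remove1 x xs. a - y)"
        by (rule prod_list_map_remove1[OF x])
      then have "vand (a # xs) = (a - x) * (\<Prod>y\<leftarrow>remove1 x xs. a - y) *
          (e * (\<Prod>y\<leftarrow>remove1 x xs. x - y) * vand (remove1 x xs))"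
        using e(2) by simp
      then show ?thesis using False by (simp add: algebra_simps)
    qed
    then show ?thesis using e(1) by auto
  qed auto
qed auto

lemma vand_eq_0_iff: "vand xs = 0 \<longleftrightarrow> \<not> distinct xs" for xs :: "'a::idom list"
  by (induction xs) (auto simp: prod_list_zero_iff)

definition linear_prod :: "'a::comm_ring_1 list \<Rightarrow> 'a poly" where
  "linear_prod ys = (\<Prod>y\<leftarrow>ys. [:- y, 1:])"

lemma poly_linear_prod: "poly (linear_prod ys) x = (\<Prod>y\<leftarrow>ys. x - y)"
  by (induction ys) (auto simp: linear_prod_def algebra_simps)

lemma degree_linear_prod: "degree (linear_prod ys) \<le> length ys"
proof (induction ys)
  case (Cons a ys)
  have "degree (linear_prod (a # ys)) \<le> degree [:-a, 1:] + degree (linear_prod ys)"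
    using degree_mult_le[of "[:-a, 1:]" "linear_prod ys"]
    by (simp add: linear_prod_def del: mult_pCons_left)
  then show ?case using Cons by (auto split: if_splits)
qed (simp add: linear_prod_def)

lemma coeff_linear_prod_length: "coeff (linear_prod ys) (length ys) = 1"
proof (induction ys)
  case (Cons a ys)
  have "coeff (linear_prod ys) (Suc (length ys)) = 0"
    using degree_linear_prod[of ys] by (intro coeff_eq_0) simp
  then show ?case using Cons by (simp add: linear_prod_def)
qed (simp add: linear_prod_def)

text \<open>Both sides have degree below the number of nodes and agree at every node.\<close>

lemma lagrange_interpolation:
  fixes f :: "'a::field poly"
  assumes "distinct xs" "degree f < length xs"
  shows "f = (\<Sum>x\<in>set xs. smult (poly f x / (\<Prod>y\<leftarrow>remove1 x xs. x - y)) (linear_prod (remove1 x xs)))"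
    (is "f = ?g")
proof (rule poly_eqI_degree)
  show "degree f < card (set xs)" using assms by (simp add: distinct_card)
  have "degree (linear_prod (remove1 x xs)) \<le> length xs - 1" if "x \<in> set xs" for x
    using degree_linear_prod[of "remove1 x xs"] that by (simp add: length_remove1)
  then have "degree ?g \<le> length xs - 1"
    by (intro degree_sum_le) (auto intro: order_trans[OF degree_smult_le])
  then show "degree ?g < card (set xs)" using assms by (simp add: distinct_card)
next
  fix z assume z: "z \<in> set xs"
  have "poly (linear_prod (remove1 x xs)) z = 0" if "x \<noteq> z" for x
    unfolding poly_linear_prod prod_list_zero_iff using z that by auto
  then have "poly ?g z = (\<Sum>x\<in>set xs. if x = z then poly f z else 0)"
    unfolding poly_sum
  proof (intro sum.cong refl)
    fix x assume x: "x \<in> set xs"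
    show "poly (smult (poly f x / (\<Prod>y\<leftarrow>remove1 x xs. x - y)) (linear_prod (remove1 x xs))) z
      = (if x = z then poly f z else 0)"
    proof (cases "x = z")
      case True
      have "(\<Prod>y\<leftarrow>remove1 z xs. z - y) \<noteq> 0"
        using assms(1) by (auto simp: prod_list_zero_iff)
      then show ?thesis using True by (simp add: poly_linear_prod)
    qed (use \<open>\<And>x. x \<noteq> z \<Longrightarrow> poly (linear_prod (remove1 x xs)) z = 0\<close> in simp)
  qed
  then show "poly f z = poly ?g z" using z by simp
qed

context subring_set
begin

lemma vand_mem: "set xs \<subseteq> D \<Longrightarrow> vand xs \<in> D"
  by (induction xs) (auto intro!: mult_mem prod_list_mem diff_mem)

lemma linear_prod_mem: "set ys \<subseteq> D \<Longrightarrow> linear_prod ys \<in> polys_over D"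
proof (induction ys)
  case (Cons a ys)
  then have "coeff (linear_prod ys) i \<in> D" for i by (simp add: polys_over_def)
  then have "coeff ([:- a, 1:] * linear_prod ys) i \<in> D" for i
    using Cons.prems by (auto simp: coeff_pCons uminus_mem_iff mult_mem split: nat.split intro!: add_mem diff_mem)
  then show ?case by (simp add: linear_prod_def polys_over_def del: mult_pCons_left)
qed (simp add: linear_prod_def polys_over_def)

text \<open>Lagrange interpolation expresses the product of a coefficient with a Vandermonde product as a
  combination of shorter Vandermonde products; \<open>z\<close> is any multiplier of the latter.\<close>

lemma coeff_vand_mem:
  assumes "set xs \<subseteq> D" "degree f < length xs" "\<And>x. x \<in> set xs \<Longrightarrow> poly f x \<in> D"
    and z: "\<And>ys. set ys \<subseteq> D \<Longrightarrow> Suc (length ys) = length xs \<Longrightarrow> vand ys * z \<in> D"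
  shows "coeff f i * vand xs * z \<in> D"
proof (cases "distinct xs")
  case True
  \<comment> \<open>Up to sign, \<open>vand xs\<close> cancels the Lagrange denominator and leaves
    \<open>vand (remove1 x xs)\<close>, which \<open>z\<close> multiplies into
    \<open>D\<close>.\<close>
  have "poly f x / (\<Prod>y\<leftarrow>remove1 x xs. x - y) * coeff (linear_prod (remove1 x xs)) i * vand xs * z \<in> D"
    if x: "x \<in> set xs" for x
  proof -
    obtain e where e: "e \<in> {1, -1}"
      "vand xs = e * (\<Prod>y\<leftarrow>remove1 x xs. x - y) * vand (remove1 x xs)"
      using vand_remove1[OF x] by blast
    have nz: "(\<Prod>y\<leftarrow>remove1 x xs. x - y) \<noteq> 0"
      using True by (auto simp: prod_list_zero_iff)
    have sub: "set (remove1 x xs) \<subseteq> D" using assms(1) set_remove1_subset[of x xs] by blast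
    have "Suc (length (remove1 x xs)) = length xs"
      using length_pos_if_in_set[OF x] x by (simp add: length_remove1)
    then have "vand (remove1 x xs) * z \<in> D" by (rule z[OF sub])
    moreover have "coeff (linear_prod (remove1 x xs)) i \<in> D"
      using linear_prod_mem[OF sub] by (simp add: polys_over_def)
    moreover have "e \<in> D" using e(1) uminus_mem by auto
    ultimately have "e * poly f x * coeff (linear_prod (remove1 x xs)) i * (vand (remove1 x xs) * z) \<in> D"
      using assms(3) x by (intro mult_mem[of _ "vand _ * z"] mult_mem[of _ "coeff _ _"] mult_mem[of e]) auto
    then show ?thesis unfolding e(2) using nz by (simp add: ac_simps)
  qed
  then have "(\<Sum>x\<in>set xs. poly f x / (\<Prod>y\<leftarrow>remove1 x xs. x - y) *
      coeff (linear_prod (remove1 x xs)) i * vand xs * z) \<in> D"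
    by (rule sum_mem)
  also have "(\<Sum>x\<in>set xs. poly f x / (\<Prod>y\<leftarrow>remove1 x xs. x - y) *
      coeff (linear_prod (remove1 x xs)) i * vand xs * z) = coeff f i * vand xs * z"
    by (subst (2) lagrange_interpolation[OF True assms(2)])
      (simp add: coeff_sum sum_distrib_right)
  finally show ?thesis .
next
  case False
  then have "vand xs = 0" by (simp add: vand_eq_0_iff)
  then show ?thesis by simp
qed

end

section \<open>The t-operation through sets with trivial inverse\<close>

text \<open>Generators of a Glaz--Vasconcelos ideal.\<close>

definition gv_set :: "'k::field set \<Rightarrow> 'k set \<Rightarrow> bool" where
  "gv_set D F \<longleftrightarrow> finite F \<and> F \<subseteq> D \<and> (\<exists>b\<in>F. b \<noteq> 0) \<and> (\<forall>x. (\<forall>b\<in>F. x * b \<in> D) \<longrightarrow> x \<in> D)"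

lemma mem_v_op_iff: "x \<in> v_op D F \<longleftrightarrow> (\<forall>y. (\<forall>b\<in>F. y * b \<in> D) \<longrightarrow> x * y \<in> D)"
  by (auto simp: v_op_def colon_def)

context subring_set
begin

text \<open>A hull and its generators have the same v-closure, so finite sets with a nonzero element
  can replace nonzero finitely generated submodules.\<close>

lemma t_op_iff:
  assumes "submodule D I"
  shows "x \<in> t_op D I \<longleftrightarrow> (\<exists>F. finite F \<and> F \<subseteq> I \<and> (\<exists>b\<in>F. b \<noteq> 0) \<and> x \<in> v_op D F)"
proof
  assume "x \<in> t_op D I"
  then obtain F where F: "finite F" "submodule D hull F \<noteq> {0}" "submodule D hull F \<subseteq> I"
    "x \<in> v_op D (submodule D hull F)"
    by (auto simp: t_op_def finitely_generated_def)
  have "\<exists>b\<in>F. b \<noteq> 0"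
  proof (rule ccontr)
    assume "\<not> ?thesis"
    then have "F \<subseteq> {0}" by auto
    moreover have "submodule D {0}" by (auto simp: submodule_def)
    ultimately have "submodule D hull F \<subseteq> {0}" by (rule hull_minimal)
    moreover have "0 \<in> submodule D hull F" using submodule_hull[of F] by (simp add: submodule_def)
    ultimately show False using F(2) by blast
  qed
  then show "\<exists>F. finite F \<and> F \<subseteq> I \<and> (\<exists>b\<in>F. b \<noteq> 0) \<and> x \<in> v_op D F"
    using F hull_subset[of F "submodule D"] v_op_hull by (intro exI[of _ F]) auto
next
  assume "\<exists>F. finite F \<and> F \<subseteq> I \<and> (\<exists>b\<in>F. b \<noteq> 0) \<and> x \<in> v_op D F"
  then obtain F b where F: "finite F" "F \<subseteq> I" "b \<in> F" "b \<noteq> 0" "x \<in> v_op D F" by blast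
  then have "submodule D hull F \<noteq> {0}" "submodule D hull F \<subseteq> I" "x \<in> v_op D (submodule D hull F)"
    using hull_subset[of F "submodule D"] hull_minimal[of F I "submodule D", OF _ assms] v_op_hull by blast+
  then show "x \<in> t_op D I" using F(1) unfolding t_op_def finitely_generated_def by blast
qed

lemma subset_t_op:
  assumes "submodule D I" "I \<noteq> {0}" shows "I \<subseteq> t_op D I"
proof
  fix x assume x: "x \<in> I"
  have "0 \<in> I" using assms by (simp add: submodule_def)
  then obtain b where "b \<in> I" "b \<noteq> 0" using assms(2) by blast
  then show "x \<in> t_op D I"
    unfolding t_op_iff[OF assms(1)] using x subset_v_op[of "{x, b}"]
    by (intro exI[of _ "{x, b}"]) auto
qed

lemma one_mem_v_op_iff: "1 \<in> v_op D F \<longleftrightarrow> (\<forall>x. (\<forall>b\<in>F. x * b \<in> D) \<longrightarrow> x \<in> D)"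
  by (simp add: mem_v_op_iff)

lemma t_op_subset: "submodule D I \<Longrightarrow> I \<subseteq> D \<Longrightarrow> t_op D I \<subseteq> D"
  unfolding subset_iff t_op_iff using v_op_subset by blast

lemma one_mem_t_op_iff:
  assumes "submodule D I" "I \<subseteq> D" shows "1 \<in> t_op D I \<longleftrightarrow> (\<exists>F\<subseteq>I. gv_set D F)"
  unfolding t_op_iff[OF assms(1)] one_mem_v_op_iff gv_set_def using assms(2) by blast

text \<open>The t-closure is all of \<open>D\<close> as soon as it contains 1, and 1 lies in the
  v-closure of \<open>F\<close> exactly when the inverse of \<open>F\<close> is contained in
  \<open>D\<close>. Through this lemma, t-invertibility, t-maximality and the w-operation are all
  handled by finite sets.\<close>

lemma t_op_eq_iff:
  assumes "submodule D I" "I \<subseteq> D" shows "t_op D I = D \<longleftrightarrow> (\<exists>F\<subseteq>I. gv_set D F)"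
proof
  assume "\<exists>F\<subseteq>I. gv_set D F"
  then obtain F where F: "F \<subseteq> I" "gv_set D F" by blast
  then have "1 \<in> v_op D F" by (simp add: one_mem_v_op_iff gv_set_def)
  then have "D \<subseteq> v_op D F" using submodule_v_op[of F] unfolding submodule_def by force
  moreover have "v_op D F \<subseteq> t_op D I"
    using F unfolding subset_iff t_op_iff[OF assms(1)] gv_set_def by blast
  ultimately show "t_op D I = D" using t_op_subset[OF assms] by blast
next
  assume "t_op D I = D"
  then show "\<exists>F\<subseteq>I. gv_set D F" using one_mem_t_op_iff[OF assms] by simp
qed

lemma t_invertible_gv_set:
  assumes "t_invertible D I"
  obtains F where "F \<subseteq> ideal_prod D I (inv_ideal D I)" "gv_set D F"
proof -
  have "ideal_prod D I (inv_ideal D I) \<subseteq> D"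
    by (rule ideal_prod_subset[OF submodule_self]) (auto simp: colon_def mult.commute)
  then show ?thesis using that assms submodule_ideal_prod
    unfolding t_invertible_def by (metis t_op_eq_iff)
qed

section \<open>Prime ideals, t-maximality and finite norm\<close>

lemma t_maximal_no_gv_set:
  assumes "t_maximal D P" "gv_set D F" shows "\<not> F \<subseteq> P"
proof
  assume "F \<subseteq> P"
  have P: "submodule D P" "P \<subseteq> D" "P \<noteq> D" "t_op D P = P"
    using assms(1) by (auto simp: t_maximal_def proper_t_ideal_def ideal_of_def star_ideal_def)
  then show False using t_op_eq_iff[OF P(1,2)] assms(2) \<open>F \<subseteq> P\<close> by blast
qed

lemma prime_mult_subset:
  assumes "prime_ideal D P" shows "mult_subset D (D - P)"
proof -
  have P: "submodule D P" "P \<subseteq> D" "P \<noteq> D" and pr: "\<And>a b. a \<in> D \<Longrightarrow> b \<in> D \<Longrightarrow> a * b \<in> P \<Longrightarrow> a \<in> P \<or> b \<in> P"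
    using assms by (auto simp: prime_ideal_def ideal_of_def)
  have "r * 1 \<in> P" if "1 \<in> P" "r \<in> D" for r using P(1) that by (auto simp only: submodule_def)
  then have "1 \<notin> P" using P by auto
  moreover have "0 \<in> P" using P(1) by (simp add: submodule_def)
  ultimately show ?thesis using pr by (auto simp: mult_subset_def intro: mult_mem)
qed

text \<open>If \<open>ab \<in> P\<close> with \<open>b \<notin> P\<close>, then \<open>(P : b)\<close> is a proper t-ideal containing \<open>P\<close> and \<open>a\<close>.\<close>

lemma t_maximal_prime:
  assumes "t_maximal D P" shows "prime_ideal D P"
proof -
  have P: "submodule D P" "P \<subseteq> D" "P \<noteq> D" "P \<noteq> {0}" "t_op D P = P"
    using assms(1) by (auto simp: t_maximal_def proper_t_ideal_def ideal_of_def star_ideal_def)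
  have Pm: "\<And>r x. r \<in> D \<Longrightarrow> x \<in> P \<Longrightarrow> r * x \<in> P" and P0: "0 \<in> P"
    using P(1) by (auto simp: submodule_def)
  have "a \<in> P" if ab: "a \<in> D" "b \<in> D" "a * b \<in> P" "b \<notin> P" for a b
  proof -
    define I where "I = {d \<in> D. d * b \<in> P}"
    have I: "submodule D I" "I \<subseteq> D"
      using P(1) unfolding I_def submodule_def
      by (auto simp: distrib_right mult.assoc intro: add_mem mult_mem)
    have PI: "P \<subseteq> I" using P(2) Pm ab(2) by (auto simp: I_def mult.commute[of _ b])
    have "1 \<notin> I" using ab(4) by (simp add: I_def)
    have I0: "I \<noteq> {0}" using PI P(4) P0 by blast
    have "t_op D I \<subseteq> I"
    proof
      fix y assume y: "y \<in> t_op D I"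
      then obtain F where F: "finite F" "F \<subseteq> I" "\<exists>c\<in>F. c \<noteq> 0" "y \<in> v_op D F"
        unfolding t_op_iff[OF I(1)] by blast
      \<comment> \<open>Multiplication by \<open>b\<close> carries the v-closure of \<open>F\<close>
        into that of \<open>b F\<close>. As \<open>b F \<subseteq> P\<close> and \<open>P\<close> is
        a t-ideal, \<open>y * b\<close> lands in \<open>P\<close>.\<close>
      have "y * b \<in> v_op D ((*) b ` F)"
      proof -
        have "y * b * x \<in> D" if "\<forall>c\<in>(*) b ` F. x * c \<in> D" for x
        proof -
          have "\<forall>c\<in>F. x * b * c \<in> D" using that by (simp add: mult.assoc)
          then have "y * (x * b) \<in> D" using F(4) unfolding mem_v_op_iff by blast
          then show ?thesis by (simp add: ac_simps)
        qed
        then show ?thesis unfolding mem_v_op_iff by blast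
      qed
      moreover have "(*) b ` F \<subseteq> P" using F(2) by (auto simp: I_def mult.commute)
      moreover have "\<exists>c\<in>(*) b ` F. c \<noteq> 0" using F(3) ab(4) P0 by auto
      ultimately have "y * b \<in> P" using F(1) t_op_iff[OF P(1)] P(5) by blast
      then show "y \<in> I" using y t_op_subset[OF I] by (auto simp: I_def)
    qed
    then have "t_op D I = I" using subset_t_op[OF I(1) I0] by blast
    moreover have "nonzero_fractional_ideal D I"
      using I I0 unfolding nonzero_fractional_ideal_def by (auto intro!: bexI[of _ 1])
    ultimately have "proper_t_ideal D I"
      using I I0 \<open>1 \<notin> I\<close> by (auto simp: proper_t_ideal_def ideal_of_def star_ideal_def)
    then have "I = P" using assms PI by (auto simp: t_maximal_def)
    then show ?thesis using ab by (auto simp: I_def)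
  qed
  then show ?thesis using P by (auto simp: prime_ideal_def ideal_of_def)
qed

text \<open>A finite integral domain is a field: two powers of \<open>a\<close> agree modulo
  \<open>P\<close>, and cancelling the smaller one leaves an inverse of \<open>a\<close> modulo
  \<open>P\<close>.\<close>

lemma finite_norm_prime_maximal:
  assumes "prime_ideal D P" "finite_norm D P" "a \<in> D - P"
  obtains b where "b \<in> D" "a * b - 1 \<in> P"
proof -
  have P: "submodule D P" and pr: "\<And>a b. a \<in> D \<Longrightarrow> b \<in> D \<Longrightarrow> a * b \<in> P \<Longrightarrow> a \<in> P \<or> b \<in> P"
    using assms by (auto simp: prime_ideal_def ideal_of_def)
  have P0: "0 \<in> P" using P by (simp add: submodule_def)
  define r where "r = {(x, y). x \<in> D \<and> y \<in> D \<and> x - y \<in> P}"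
  have an: "a ^ n \<in> D - P" for n
  proof -
    interpret localized D "D - P" by standard (rule prime_mult_subset[OF assms(1)])
    show ?thesis
    proof (induction n)
      case 0
      show ?case using one_S by simp
    qed (use assms(3) mult_S in auto)
  qed
  have "finite (range (\<lambda>i. r `` {a ^ i}))"
    by (rule finite_subset[OF _ assms(2)[unfolded finite_norm_def, folded r_def]])
      (use an in \<open>auto intro: quotientI\<close>)
  then have "\<not> inj (\<lambda>i::nat. r `` {a ^ i})" using finite_imageD infinite_UNIV_nat by blast
  then obtain i j :: nat where ij: "i < j" "r `` {a ^ i} = r `` {a ^ j}"
    unfolding inj_def by (metis linorder_neqE_nat)
  have "a ^ j \<in> r `` {a ^ j}" using an[of j] P0 by (auto simp: r_def)
  then have "a ^ i - a ^ j \<in> P" using ij(2) by (auto simp: r_def)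
  moreover obtain k where k: "j = Suc (i + k)" using less_imp_Suc_add[OF ij(1)] by blast
  ultimately have "a ^ i * (1 - a * a ^ k) \<in> P" by (simp add: right_diff_distrib power_add ac_simps)
  moreover have "1 - a * a ^ k \<in> D" using an[of k] assms(3) by (intro diff_mem mult_mem) auto
  ultimately have "1 - a * a ^ k \<in> P" using pr an[of i] by blast
  then have "0 - (1 - a * a ^ k) \<in> P" by (rule submodule_diff[OF P P0])
  then show ?thesis using that[of "a ^ k"] an[of k] by simp
qed

text \<open>Finite norm makes \<open>P\<close> a maximal ideal, so \<open>P\<close> would be
  t-maximal if it were a t-ideal. Hence some \<open>y\<close> outside \<open>P\<close> lies in the
  v-closure of a finite subset of \<open>P\<close>.\<close>

lemma finite_norm_not_t_maximal:
  assumes "prime_ideal D P" "finite_norm D P" "P \<noteq> {0}" "\<not> t_maximal D P"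
  obtains F where "F \<subseteq> P" "gv_set D F"
proof -
  have P: "submodule D P" "P \<subseteq> D" "P \<noteq> D" using assms by (auto simp: prime_ideal_def ideal_of_def)
  have one: "1 \<in> I" if I: "submodule D I" "P \<subseteq> I" "a \<in> I" "a \<in> D - P" for I a
  proof -
    obtain b where b: "b \<in> D" "a * b - 1 \<in> P"
      using finite_norm_prime_maximal[OF assms(1,2) I(4)] .
    have "b * a \<in> I" using I b by (auto simp: submodule_def)
    then have "b * a - (a * b - 1) \<in> I" using I(2) b(2) submodule_diff[OF I(1)] by blast
    then show ?thesis by (simp add: mult.commute)
  qed
  have "\<not> star_ideal t_op D P"
  proof
    assume "star_ideal t_op D P"
    then have pt: "proper_t_ideal D P" using P assms(3) by (simp add: proper_t_ideal_def ideal_of_def)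
    have "I = P" if pI: "proper_t_ideal D I" "P \<subseteq> I" for I
    proof (rule ccontr)
      assume "I \<noteq> P"
      moreover have I: "submodule D I" "I \<subseteq> D" "I \<noteq> D"
        using pI(1) by (auto simp: proper_t_ideal_def ideal_of_def)
      ultimately obtain a where "a \<in> I" "a \<in> D - P" using pI(2) by blast
      then have "1 \<in> I" by (rule one[OF I(1) pI(2)])
      then have "r * 1 \<in> I" if "r \<in> D" for r using I(1) that by (simp only: submodule_def)
      then show False using I by auto
    qed
    then show False using pt assms(4) by (simp add: t_maximal_def)
  qed
  moreover have "nonzero_fractional_ideal D P"
    using P assms(3) unfolding nonzero_fractional_ideal_def by (auto intro!: bexI[of _ 1])
  ultimately have "t_op D P \<noteq> P" by (simp add: star_ideal_def)
  then obtain y where y: "y \<in> t_op D P" "y \<notin> P" using subset_t_op[OF P(1) assms(3)] by blast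
  then obtain F where F: "finite F" "F \<subseteq> P" "\<exists>b\<in>F. b \<noteq> 0" "y \<in> v_op D F"
    unfolding t_op_iff[OF P(1)] by blast
  have yD: "y \<in> D - P" using y t_op_subset[OF P(1,2)] by blast
  then obtain b where b: "b \<in> D" "y * b - 1 \<in> P"
    using finite_norm_prime_maximal[OF assms(1,2)] by blast
  \<comment> \<open>The v-closure of \<open>G\<close> contains both \<open>y * b\<close> and
    \<open>y * b - 1\<close>, hence their difference 1.\<close>
  define G where "G = insert (y * b - 1) F"
  have "y \<in> v_op D G" using F(4) unfolding mem_v_op_iff G_def by auto
  then have "b * y \<in> v_op D G" using b(1) submodule_v_op[of G] by (simp add: submodule_def)
  moreover have "y * b - 1 \<in> v_op D G" using subset_v_op[of G] by (auto simp: G_def)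
  ultimately have "b * y - (y * b - 1) \<in> v_op D G" by (rule submodule_diff[OF submodule_v_op])
  then have "1 \<in> v_op D G" by (simp add: mult.commute)
  moreover have G: "G \<subseteq> P" "finite G" "\<exists>b\<in>G. b \<noteq> 0" using F(1-3) b(2) by (auto simp: G_def)
  ultimately have "gv_set D G" using P(2) unfolding gv_set_def one_mem_v_op_iff by blast
  then show ?thesis by (rule that[OF G(1)])
qed

text \<open>By Zorn's lemma there is an ideal maximal among those that contain \<open>I\<close> and
  omit 1; such an ideal is prime.\<close>

lemma exists_prime_ideal:
  assumes "submodule D I" "I \<subseteq> D" "1 \<notin> I"
  obtains P where "prime_ideal D P" "I \<subseteq> P"
proof -
  define Z where "Z = {J. submodule D J \<and> J \<subseteq> D \<and> I \<subseteq> J \<and> 1 \<notin> J}"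
  have "\<exists>M\<in>Z. \<forall>X\<in>Z. M \<subseteq> X \<longrightarrow> X = M"
  proof (rule subset_Zorn_nonempty)
    show "Z \<noteq> {}" using assms by (auto simp: Z_def)
    fix C assume C: "C \<noteq> {}" "subset.chain Z C"
    then have CZ: "C \<subseteq> Z" and ch: "\<And>X Y. X \<in> C \<Longrightarrow> Y \<in> C \<Longrightarrow> X \<subseteq> Y \<or> Y \<subseteq> X"
      by (auto simp: subset_chain_def)
    have "submodule D (\<Union> C)"
      unfolding submodule_def
    proof (intro conjI ballI)
      show "0 \<in> \<Union> C" using C(1) CZ by (auto simp: Z_def submodule_def)
    next
      fix x y assume "x \<in> \<Union> C" "y \<in> \<Union> C"
      then obtain X where "X \<in> C" "x \<in> X" "y \<in> X" using ch by blast
      moreover then have "submodule D X" using CZ by (auto simp: Z_def)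
      ultimately show "x + y \<in> \<Union> C" unfolding submodule_def by blast
    next
      fix r x assume "r \<in> D" "x \<in> \<Union> C"
      then obtain X where "X \<in> C" "x \<in> X" by blast
      moreover then have "submodule D X" using CZ by (auto simp: Z_def)
      ultimately show "r * x \<in> \<Union> C" using \<open>r \<in> D\<close> unfolding submodule_def by blast
    qed
    then show "\<Union> C \<in> Z" using C(1) CZ by (auto simp: Z_def)
  qed
  then obtain P where PZ: "P \<in> Z" and max: "\<And>X. X \<in> Z \<Longrightarrow> P \<subseteq> X \<Longrightarrow> X = P" by blast
  have P: "submodule D P" "P \<subseteq> D" "I \<subseteq> P" "1 \<notin> P" using PZ by (auto simp: Z_def)
  have "a \<in> P" if ab: "a \<in> D" "b \<in> D" "a * b \<in> P" "b \<notin> P" for a b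
  proof -
    \<comment> \<open>This is \<open>P + D b\<close>, strictly larger than \<open>P\<close>, so by
      maximality it contains 1. Multiplying \<open>1 = p + d * b\<close> by \<open>a\<close> puts
      \<open>a\<close> into \<open>P\<close>.\<close>
    define J where "J = {p + d * b | p d. p \<in> P \<and> d \<in> D}"
    have J: "submodule D J"
      unfolding submodule_def
    proof (intro conjI ballI)
      show "0 \<in> J" using P(1) unfolding J_def submodule_def
        by (intro CollectI exI[of _ 0]) auto
    next
      fix x y assume "x \<in> J" "y \<in> J"
      then obtain p d q e where *: "x = p + d * b" "y = q + e * b" "p \<in> P" "q \<in> P" "d \<in> D" "e \<in> D"
        by (auto simp: J_def)
      have "x + y = (p + q) + (d + e) * b" using * by (simp add: algebra_simps)
      moreover have "p + q \<in> P" "d + e \<in> D" using * P(1) add_mem by (auto simp: submodule_def)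
      ultimately show "x + y \<in> J" unfolding J_def by blast
    next
      fix r x assume "r \<in> D" "x \<in> J"
      then obtain p d where *: "x = p + d * b" "p \<in> P" "d \<in> D" by (auto simp: J_def)
      have "r * x = r * p + (r * d) * b" using * by (simp add: algebra_simps)
      moreover have "r * p \<in> P" "r * d \<in> D" using * P(1) \<open>r \<in> D\<close> mult_mem by (auto simp: submodule_def)
      ultimately show "r * x \<in> J" unfolding J_def by blast
    qed
    have "P \<subseteq> J"
    proof
      fix p assume "p \<in> P"
      then have "p = p + 0 * b \<and> p \<in> P \<and> 0 \<in> D" by simp
      then show "p \<in> J" unfolding J_def by blast
    qed
    have "b = 0 + 1 * b \<and> 0 \<in> P \<and> 1 \<in> D" using P(1) by (simp add: submodule_def)
    then have "b \<in> J" unfolding J_def by blast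
    have "J \<subseteq> D" using P(2) ab(2) by (auto simp: J_def intro!: add_mem mult_mem)
    have "1 \<in> J"
    proof (rule ccontr)
      assume "1 \<notin> J"
      then have "J \<in> Z" using J \<open>P \<subseteq> J\<close> \<open>J \<subseteq> D\<close> P(3) by (auto simp: Z_def)
      then show False using max[of J] \<open>P \<subseteq> J\<close> \<open>b \<in> J\<close> ab(4) by blast
    qed
    then obtain p d where pd: "1 = p + d * b" "p \<in> P" "d \<in> D" by (auto simp: J_def)
    have "a * p + d * (a * b) \<in> P" using P(1) pd(2,3) ab by (simp add: submodule_def)
    also have "a * p + d * (a * b) = a * (p + d * b)" by (simp add: algebra_simps)
    finally show "a \<in> P" unfolding pd(1)[symmetric] by simp
  qed
  then have "prime_ideal D P" using P by (auto simp: prime_ideal_def ideal_of_def)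
  then show ?thesis using that P(3) by blast
qed

end

section \<open>Characteristic ideals\<close>

context subring_set
begin

lemma char_ideal_0: "char_ideal 0 D = D"
proof
  show "char_ideal 0 D \<subseteq> D"
  proof
    fix c assume "c \<in> char_ideal 0 D"
    then obtain f where f: "f \<in> Int_poly D" "degree f \<le> 0" "coeff f 0 = c" by (rule char_idealE)
    then have "poly f 0 = c" by (simp add: poly_0_coeff_0)
    then show "c \<in> D" using f(1) by (auto simp: Int_poly_def)
  qed
  show "D \<subseteq> char_ideal 0 D"
  proof
    fix c assume "c \<in> D"
    then show "c \<in> char_ideal 0 D" using Int_poly_leI[of "[:c:]" D 0] by (simp add: Int_poly_def)
  qed
qed

lemma char_ideal_mult:
  assumes "a \<in> char_ideal k D" "b \<in> char_ideal l D" shows "a * b \<in> char_ideal (k + l) D"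
proof -
  obtain f where f: "f \<in> Int_poly D" "degree f \<le> k" "coeff f k = a" using assms(1) by (rule char_idealE)
  obtain g where g: "g \<in> Int_poly D" "degree g \<le> l" "coeff g l = b" using assms(2) by (rule char_idealE)
  have "f * g \<in> Int_poly D" using f g by (auto simp: Int_poly_def intro: mult_mem)
  moreover have "degree (f * g) \<le> k + l" using f g by (intro order_trans[OF degree_mult_le]) simp
  ultimately have "coeff (f * g) (k + l) \<in> char_ideal (k + l) D" by (rule Int_poly_leI)
  \<comment> \<open>For \<open>i < k\<close> the index of \<open>g\<close> exceeds its degree bound,
    for \<open>i > k\<close> that of \<open>f\<close> does; only \<open>i = k\<close>
    survives.\<close>
  also have "coeff (f * g) (k + l) = (\<Sum>i\<le>k + l. if i = k then a * b else 0)"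
    unfolding coeff_mult
  proof (intro sum.cong refl)
    fix i assume "i \<in> {..k + l}"
    then show "coeff f i * coeff g (k + l - i) = (if i = k then a * b else 0)"
      using f g by (cases i k rule: linorder_cases) (auto simp: coeff_eq_0)
  qed
  finally show ?thesis by simp
qed

lemma submodule_char_ideal: "submodule D (char_ideal n D)"
  unfolding submodule_def
proof (intro conjI ballI)
  show "0 \<in> char_ideal n D" using Int_poly_leI[of 0 D n] by (simp add: Int_poly_def)
next
  fix x y assume "x \<in> char_ideal n D" "y \<in> char_ideal n D"
  then obtain f g where "f \<in> Int_poly D" "degree f \<le> n" "coeff f n = x"
    "g \<in> Int_poly D" "degree g \<le> n" "coeff g n = y" by (metis char_idealE)
  then show "x + y \<in> char_ideal n D"
    using Int_poly_leI[of "f + g" D n] by (auto simp: Int_poly_def intro: add_mem degree_add_le)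
next
  fix r x assume "r \<in> D" "x \<in> char_ideal n D"
  \<comment> \<open>Scalars are the elements of the characteristic ideal of index 0.\<close>
  then show "r * x \<in> char_ideal n D" using char_ideal_mult[of r 0 x n] char_ideal_0 by simp
qed

text \<open>The leading coefficient of a linear polynomial is its value at 1 minus its value at
  0.\<close>

lemma char_ideal_1: "char_ideal 1 D = D"
proof
  show "char_ideal 1 D \<subseteq> D"
  proof
    fix c assume "c \<in> char_ideal 1 D"
    then obtain f where f: "f \<in> Int_poly D" "degree f \<le> 1" "coeff f 1 = c" by (rule char_idealE)
    then have "poly f 1 - poly f 0 \<in> D" by (intro diff_mem) (auto simp: Int_poly_def)
    moreover have "poly f x = coeff f 0 + coeff f 1 * x" for x
    proof -
      have "f = [:coeff f 0, coeff f 1:]"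
        by (rule poly_eqI) (use f(2) in \<open>auto simp: coeff_pCons coeff_eq_0 split: nat.split\<close>)
      then show ?thesis by (metis poly_pCons poly_0 mult_zero_right add_0_right mult.commute)
    qed
    ultimately show "c \<in> D" using f(3) by simp
  qed
  show "D \<subseteq> char_ideal 1 D"
  proof
    fix c assume "c \<in> D"
    then have "coeff [:0, c:] 1 \<in> char_ideal 1 D"
      by (intro Int_poly_leI) (auto simp: Int_poly_def intro: mult_mem)
    then show "c \<in> char_ideal 1 D" by simp
  qed
qed

text \<open>This is multiplication by \<open>X\<close>, which contributes the leading coefficient 1
  in degree 1.\<close>

lemma char_ideal_Suc: "char_ideal n D \<subseteq> char_ideal (Suc n) D"
  using char_ideal_mult[of _ n 1 1] char_ideal_1 by auto

lemma subset_char_ideal: "D \<subseteq> char_ideal n D"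
  by (induction n) (use char_ideal_0 char_ideal_Suc in auto)

lemma char_ideal_mono: "k \<le> n \<Longrightarrow> char_ideal k D \<subseteq> char_ideal n D"
  by (rule lift_Suc_mono_le[of "\<lambda>n. char_ideal n D", OF char_ideal_Suc])

lemma fact_ideal_antimono: "k \<le> n \<Longrightarrow> fact_ideal n D \<subseteq> fact_ideal k D"
  using char_ideal_mono by (auto simp: fact_ideal_def colon_def)

lemma fact_ideal_mult:
  assumes "x \<in> fact_ideal n D" "c \<in> char_ideal n D" shows "x * c \<in> D"
  using assms by (auto simp: fact_ideal_def colon_def)

lemma fact_ideal_subset: "fact_ideal n D \<subseteq> D"
proof
  fix x assume "x \<in> fact_ideal n D"
  moreover have "1 \<in> char_ideal n D" using subset_char_ideal one_mem by blast
  ultimately show "x \<in> D" using fact_ideal_mult[of x n 1] by simp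
qed

lemma inv_ideal_self: "inv_ideal D D = D"
  by (auto simp: colon_def mult_mem dest: bspec[of _ _ 1])

end

section \<open>Localization at a prime ideal\<close>

locale localized_at_prime = subring_set D for D :: "'k::field set" +
  fixes P :: "'k set"
  assumes prime: "prime_ideal D P"

sublocale localized_at_prime \<subseteq> localized D "D - P"
  by standard (rule prime_mult_subset[OF prime])

context localized_at_prime
begin

abbreviation DP :: "'k set" where "DP \<equiv> localize (D - P) D"

lemma submodule_P: "submodule D P" and P_subset: "P \<subseteq> D"
  using prime by (auto simp: prime_ideal_def ideal_of_def)

lemma mult_P: "r \<in> D \<Longrightarrow> x \<in> P \<Longrightarrow> r * x \<in> P"
  using submodule_P by (auto simp: submodule_def)

lemma zero_P: "0 \<in> P"
  using submodule_P by (simp add: submodule_def)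

text \<open>With infinitely many residue classes there is always a further point incongruent to
  those already chosen. Primality keeps the product of the differences outside
  \<open>P\<close>.\<close>

lemma infinite_norm_vand:
  assumes "\<not> finite_norm D P"
  shows "\<exists>xs. length xs = n \<and> set xs \<subseteq> D \<and> vand xs \<in> D - P"
proof (induction n)
  case 0
  show ?case using one_S by simp
next
  case (Suc n)
  then obtain xs where xs: "length xs = n" "set xs \<subseteq> D" "vand xs \<in> D - P" by blast
  define r where "r = {(x, y). x \<in> D \<and> y \<in> D \<and> x - y \<in> P}"
  have "\<exists>x\<in>D. \<forall>y\<in>set xs. x - y \<notin> P"
  proof (rule ccontr)
    assume neg: "\<not> ?thesis"
    \<comment> \<open>Were every \<open>x\<close> congruent to an entry of \<open>xs\<close>, the
      classes of these finitely many entries would exhaust the quotient.\<close>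
    have "D // r \<subseteq> (\<lambda>y. r `` {y}) ` set xs"
    proof
      fix c assume "c \<in> D // r"
      then obtain x where x: "x \<in> D" "c = r `` {x}" by (auto simp: quotient_def)
      then obtain y where y: "y \<in> set xs" "x - y \<in> P" using neg by blast
      have "x - w \<in> P \<longleftrightarrow> y - w \<in> P" for w
      proof
        assume "x - w \<in> P"
        then have "(x - w) - (x - y) \<in> P" by (rule submodule_diff[OF submodule_P _ y(2)])
        then show "y - w \<in> P" by simp
      next
        assume "y - w \<in> P"
        then have "(y - w) + (x - y) \<in> P" using y submodule_P unfolding submodule_def by blast
        then show "x - w \<in> P" by simp
      qed
      then have "c = r `` {y}" using x y xs(2) by (auto simp: r_def)
      then show "c \<in> (\<lambda>y. r `` {y}) ` set xs" using y(1) by blast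
    qed
    then have "finite (D // r)" by (rule finite_subset) simp
    then show False using assms by (simp add: finite_norm_def r_def)
  qed
  then obtain x where x: "x \<in> D" "\<And>y. y \<in> set xs \<Longrightarrow> x - y \<notin> P" by blast
  have "(\<Prod>y\<leftarrow>ys. x - y) \<in> D - P" if "set ys \<subseteq> set xs" for ys
    using that
  proof (induction ys)
    case Nil
    show ?case using one_S by simp
  next
    case (Cons a ys)
    then have "x - a \<in> D - P" using x xs(2) by (auto intro: diff_mem)
    then show ?case using Cons mult_S by simp
  qed
  then have "vand (x # xs) \<in> D - P" using mult_S xs(3) by simp
  then show ?case using xs x(1) by (intro exI[of _ "x # xs"]) auto
qed

lemma coeff_mem_infinite_norm:
  assumes "\<not> finite_norm D P" "f \<in> Int_poly DP"
  shows "coeff f i \<in> DP"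
proof -
  obtain xs where xs: "length xs = Suc (degree f)" "set xs \<subseteq> D" "vand xs \<in> D - P"
    using infinite_norm_vand[OF assms(1)] by blast
  have sub: "set xs \<subseteq> DP" using xs(2) loc_subset by blast
  \<comment> \<open>The multiplier \<open>z\<close> is taken to be 1, since Vandermonde products of
    points of \<open>DP\<close> lie in \<open>DP\<close> anyway.\<close>
  have "coeff f i * vand xs * 1 \<in> DP"
    by (rule L.coeff_vand_mem[OF sub])
      (use xs(1) sub assms(2) L.vand_mem in \<open>auto simp: Int_poly_def\<close>)
  then show ?thesis using cancel_S[OF xs(3)] by (simp add: mult.commute)
qed

text \<open>Here \<open>b\<^sup>j - b\<^sup>k = b\<^sup>j (1 - b\<^bsup>k-j\<^esup>)\<close> for \<open>j < k\<close>, and the second factor is a unit at \<open>P\<close>.\<close>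

lemma vand_powers:
  assumes b: "b \<in> P"
  shows "sorted_wrt (<) js \<Longrightarrow> \<exists>N. \<exists>u\<in>D - P. vand (map (\<lambda>j::nat. b ^ j) js) = b ^ N * u"
proof (induction js)
  case Nil
  show ?case using one_S by (intro exI[of _ 0] bexI[of _ 1]) auto
next
  case (Cons j js)
  have bD: "b \<in> D" using b P_subset by blast
  have "\<exists>N. \<exists>u\<in>D - P. (\<Prod>y\<leftarrow>map (\<lambda>j. b ^ j) ks. b ^ j - y) = b ^ N * u"
    if "\<forall>k\<in>set ks. j < k" for ks
    using that
  proof (induction ks)
    case Nil
    show ?case using one_S by (intro exI[of _ 0] bexI[of _ 1]) auto
  next
    case (Cons k ks)
    then obtain N u where N: "u \<in> D - P" "(\<Prod>y\<leftarrow>map (\<lambda>j. b ^ j) ks. b ^ j - y) = b ^ N * u" by auto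
    have k: "j < k" using Cons.prems by simp
    have "b ^ (k - j - 1) * b \<in> P" using b bD by (intro mult_P power_mem)
    then have bk: "b ^ (k - j) \<in> P"
      using k by (metis Suc_diff_Suc diff_diff_left plus_1_eq_Suc add.commute power_Suc2)
    have "1 - b ^ (k - j) \<in> D - P"
    proof
      show "1 - b ^ (k - j) \<in> D" using bD by (intro diff_mem power_mem) auto
      show "1 - b ^ (k - j) \<notin> P"
      proof
        assume "1 - b ^ (k - j) \<in> P"
        then have "(1 - b ^ (k - j)) + b ^ (k - j) \<in> P"
          using bk submodule_P by (simp only: submodule_def)
        then show False using one_S by simp
      qed
    qed
    then have u: "(1 - b ^ (k - j)) * u \<in> D - P" by (rule mult_S[OF _ N(1)])
    have "b ^ j - b ^ k = b ^ j * (1 - b ^ (k - j))"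
      using k by (simp add: right_diff_distrib flip: power_add)
    then have "(\<Prod>y\<leftarrow>map (\<lambda>j. b ^ j) (k # ks). b ^ j - y) = b ^ (j + N) * ((1 - b ^ (k - j)) * u)"
      using N(2) by (simp add: power_add)
    then show ?case using u by blast
  qed
  then obtain N u where N: "u \<in> D - P" "(\<Prod>y\<leftarrow>map (\<lambda>j. b ^ j) js. b ^ j - y) = b ^ N * u"
    using Cons.prems by fastforce
  obtain M v where M: "v \<in> D - P" "vand (map (\<lambda>j. b ^ j) js) = b ^ M * v"
    using Cons by auto
  have "vand (map (\<lambda>j. b ^ j) (j # js)) = b ^ (N + M) * (u * v)"
    using N(2) M(2) by (simp add: power_add)
  then show ?case using mult_S[OF N(1) M(1)] by blast
qed

text \<open>Interpolation at the \<open>degree f + 1\<close> points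
  \<open>b ^ 0, b ^ 1, ...\<close>, whose Vandermonde product is a power of \<open>b\<close> times a
  unit at \<open>P\<close>.\<close>

lemma coeff_power_mem:
  assumes "b \<in> P" "f \<in> Int_poly DP"
  shows "\<exists>N. coeff f i * b ^ N \<in> DP"
proof -
  define xs where "xs = map (\<lambda>j. b ^ j) [0..<Suc (degree f)]"
  obtain N u where N: "u \<in> D - P" "vand xs = b ^ N * u"
    unfolding xs_def using vand_powers[OF assms(1) sorted_wrt_upt] by blast
  have "b \<in> DP" using assms(1) P_subset loc_subset by blast
  then have sub: "set xs \<subseteq> DP" by (auto simp: xs_def intro!: L.power_mem)
  have "coeff f i * vand xs * 1 \<in> DP"
    by (rule L.coeff_vand_mem[OF sub])
      (use sub assms(2) L.vand_mem in \<open>auto simp: Int_poly_def xs_def\<close>)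
  then have "u * (coeff f i * b ^ N) \<in> DP" unfolding N(2) by (simp add: ac_simps)
  then show ?thesis using cancel_S[OF N(1)] by blast
qed

text \<open>Finiteness of \<open>F\<close> yields one denominator for all products
  \<open>x * b\<close>; the triviality of the inverse of \<open>F\<close> over \<open>D\<close> then
  does the rest.\<close>

lemma gv_set_localize:
  assumes "gv_set D F" "\<forall>b\<in>F. x * b \<in> DP"
  shows "x \<in> DP"
proof -
  obtain s where s: "s \<in> D - P" "\<forall>b\<in>F. s * (x * b) \<in> D"
    using finite_common_denominator[of F "\<lambda>b. x * b" D] assms submodule_self
    by (auto simp: gv_set_def)
  then have "s * x \<in> D" using assms(1) by (simp add: gv_set_def mult.assoc)
  then show ?thesis using s(1) loc_iff by blast
qed

text \<open>Induction on the sum of the exponents. For each \<open>b\<close>, the element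
  \<open>x * b\<close> satisfies the hypothesis with the exponent of \<open>b\<close> lowered by
  one, so \<open>x\<close> multiplies all of \<open>F\<close> into \<open>DP\<close>. An exponent 0
  ends the descent, as then \<open>x\<close> itself is in \<open>DP\<close>.\<close>

lemma gv_set_powers:
  fixes e :: "'k \<Rightarrow> nat"
  assumes gv: "gv_set D F"
  shows "(\<forall>b\<in>F. x * b ^ e b \<in> DP) \<Longrightarrow> x \<in> DP"
proof (induction "sum e F" arbitrary: e x rule: less_induct)
  case less
  have F: "finite F" "F \<subseteq> D" using gv by (auto simp: gv_set_def)
  show ?case
  proof (cases "\<exists>b\<in>F. e b = 0")
    case True
    then obtain b where "b \<in> F" "e b = 0" by blast
    then show ?thesis using less.prems by force
  next
    case False
    have "x * b \<in> DP" if b: "b \<in> F" for b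
    proof (rule less.hyps)
      show "sum (e(b := e b - 1)) F < sum e F"
      proof (rule sum_strict_mono_ex1[OF F(1)])
        show "\<exists>a\<in>F. (e(b := e b - 1)) a < e a" using b False by (intro bexI[of _ b]) auto
      qed auto
      show "\<forall>c\<in>F. x * b * c ^ (e(b := e b - 1)) c \<in> DP"
      proof
        fix c assume c: "c \<in> F"
        show "x * b * c ^ (e(b := e b - 1)) c \<in> DP"
        proof (cases "c = b")
          case True
          have "b * b ^ (e b - 1) = b ^ e b" using False b by (metis power_minus_mult neq0_conv mult.commute)
          then show ?thesis using True less.prems b by (auto simp: mult.assoc)
        next
          case False
          have "b \<in> DP" using b F loc_subset by blast
          then have "b * (x * c ^ e c) \<in> DP" using less.prems c L.mult_mem by blast
          then show ?thesis using False by (simp add: ac_simps)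
        qed
      qed
    qed
    then show ?thesis using gv_set_localize[OF gv] by blast
  qed
qed

lemma coeff_mem_gv_set:
  assumes "gv_set D F" "F \<subseteq> P" "f \<in> Int_poly DP"
  shows "coeff f i \<in> DP"
proof -
  have "\<forall>b\<in>F. \<exists>N. coeff f i * b ^ N \<in> DP" using coeff_power_mem assms(2,3) by blast
  then obtain e where "\<forall>b\<in>F. coeff f i * b ^ e b \<in> DP" by metis
  then show ?thesis by (rule gv_set_powers[OF assms(1)])
qed

text \<open>Three cases: for infinite norm some Vandermonde product is a unit at \<open>P\<close>;
  for \<open>P = {0}\<close> the ring \<open>DP\<close> is the whole field; a nonzero
  \<open>P\<close> of finite norm that is not t-maximal contains a \<open>gv_set\<close>.\<close>

lemma Int_poly_trivial:
  assumes "domain_with_quotient_field D" "\<not> (t_maximal D P \<and> finite_norm D P)"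
  shows "Int_poly DP = polys_over DP"
proof
  have "coeff f i \<in> DP" if f: "f \<in> Int_poly DP" for f i
  proof (cases "finite_norm D P")
    case True
    show ?thesis
    proof (cases "P = {0}")
      case True
      obtain a b where ab: "a \<in> D" "b \<in> D" "b \<noteq> 0" "coeff f i = a / b"
        using assms(1) unfolding domain_with_quotient_field_def by blast
      then show ?thesis unfolding loc_iff using True by (intro bexI[of _ b]) auto
    next
      case False
      then show ?thesis
        using finite_norm_not_t_maximal[OF prime True] assms(2) True coeff_mem_gv_set f by metis
    qed
  qed (rule coeff_mem_infinite_norm[OF _ f])
  then show "Int_poly DP \<subseteq> polys_over DP" by (auto simp: polys_over_def)
qed (rule L.polys_over_subset_Int_poly)

lemma char_ideal_trivial:
  assumes "Int_poly DP = polys_over DP" shows "char_ideal n DP = DP"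
proof
  show "char_ideal n DP \<subseteq> DP"
    using assms by (auto simp: char_ideal_def Int_poly_le_def polys_over_def)
qed (rule L.subset_char_ideal)

lemma polys_over_subset_localize: "polys_over DP \<subseteq> localize_poly (D - P) (Int_poly D)"
proof
  fix f assume f: "f \<in> polys_over DP"
  have "a \<in> DP" if "a \<in> set (coeffs f)" for a
    using that f by (auto simp: polys_over_def coeffs_def split: if_splits)
  then have "\<exists>s\<in>D - P. \<forall>a\<in>set (coeffs f). s * a \<in> D"
    by (intro finite_common_denominator submodule_self) auto
  then obtain s where s: "s \<in> D - P" "\<And>a. a \<in> set (coeffs f) \<Longrightarrow> s * a \<in> D" by blast
  have "coeff (smult s f) i \<in> D" for i
    using s(2)[of "coeff f i"] coeff_in_coeffs[of f i] by (cases "f = 0 \<or> i > degree f") (auto simp: coeff_eq_0)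
  then have "smult s f \<in> Int_poly D" using polys_over_subset_Int_poly by (auto simp: polys_over_def)
  then show "f \<in> localize_poly (D - P) (Int_poly D)" using s(1) loc_poly_iff by blast
qed

end

section \<open>Divisorial properties of characteristic ideals\<close>

text \<open>For submodules this is the usual \<open>(A A^-1)_v = D\<close>, expressed by
  \<open>(A A^-1)^-1 \<subseteq> D\<close>. Testing on single products allows \<open>A\<close> to be
  a mere set such as \<open>vands n D\<close>.\<close>

definition v_invertible :: "'k::field set \<Rightarrow> 'k set \<Rightarrow> bool" where
  "v_invertible D A \<longleftrightarrow> (\<forall>y. (\<forall>a\<in>A. \<forall>b\<in>inv_ideal D A. y * (a * b) \<in> D) \<longrightarrow> y \<in> D)"

lemma v_invertibleD:
  "v_invertible D A \<Longrightarrow> (\<And>a b. a \<in> A \<Longrightarrow> b \<in> inv_ideal D A \<Longrightarrow> y * (a * b) \<in> D) \<Longrightarrow> y \<in> D"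
  by (auto simp: v_invertible_def)

definition vands :: "nat \<Rightarrow> 'k::field set \<Rightarrow> 'k set" where
  "vands n D = {vand xs | xs. length xs = n \<and> set xs \<subseteq> D}"

context subring_set
begin

lemma submodule_vimage_mult: "submodule D M \<Longrightarrow> submodule D {z. u * z \<in> M}"
  unfolding submodule_def by (auto simp: distrib_left mult.left_commute)

text \<open>The ideal \<open>I I^-1\<close> contains a set with trivial inverse, and whatever
  multiplies \<open>I I^-1\<close> into \<open>D\<close> also multiplies this set into
  \<open>D\<close>.\<close>

lemma t_invertible_imp_v_invertible:
  assumes "t_invertible D I" shows "v_invertible D I"
  unfolding v_invertible_def
proof (intro allI impI)
  fix y assume y: "\<forall>a\<in>I. \<forall>b\<in>inv_ideal D I. y * (a * b) \<in> D"
  obtain F where F: "F \<subseteq> ideal_prod D I (inv_ideal D I)" "gv_set D F"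
    using t_invertible_gv_set[OF assms] .
  have "ideal_prod D I (inv_ideal D I) \<subseteq> {z. y * z \<in> D}"
    using y by (intro ideal_prod_subset submodule_vimage_mult submodule_self) auto
  then have "\<forall>z\<in>F. y * z \<in> D" using F(1) by blast
  then show "y \<in> D" using F(2) by (simp add: gv_set_def)
qed

lemma exists_distinct_list:
  assumes "infinite D" shows "\<exists>xs. length xs = n \<and> set xs \<subseteq> D \<and> distinct xs"
proof -
  obtain B where "finite B" "card B = n" "B \<subseteq> D" using infinite_arbitrarily_large[OF assms] by blast
  then show ?thesis using finite_distinct_list[of B] distinct_card by metis
qed

lemma finite_domain_UNIV:
  assumes "domain_with_quotient_field D" "finite D" shows "D = UNIV"
proof -
  have "x \<in> D" for x
  proof -
    obtain a b where ab: "a \<in> D" "b \<in> D" "b \<noteq> 0" "x = a / b"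
      using assms(1) unfolding domain_with_quotient_field_def by blast
    have "(*) b ` D = D"
      using ab by (intro endo_inj_surj[OF assms(2)]) (auto intro: mult_mem inj_onI)
    then obtain y where "y \<in> D" "b * y = 1" using one_mem by (metis imageE)
    then have "y = inverse b" by (metis inverse_unique)
    then have "x = a * y" using ab by (simp add: divide_inverse)
    then show ?thesis using ab \<open>y \<in> D\<close> mult_mem by blast
  qed
  then show ?thesis by auto
qed

text \<open>The inclusion of \<open>c V_(n+1)\<close> in the ideal generated by \<open>V_n\<close>,
  tested against the inverse of \<open>V_n\<close>; this weaker form is all that arguments with
  v-closures use.\<close>

lemma coeff_vands_mem:
  assumes "f \<in> Int_poly D" "degree f \<le> n" "\<delta> \<in> vands (Suc n) D" "z \<in> inv_ideal D (vands n D)"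
  shows "coeff f i * \<delta> * z \<in> D"
proof -
  obtain xs where xs: "\<delta> = vand xs" "length xs = Suc n" "set xs \<subseteq> D"
    using assms(3) by (auto simp: vands_def)
  show ?thesis unfolding xs(1)
  proof (rule coeff_vand_mem)
    fix ys assume "set ys \<subseteq> D" "Suc (length ys) = length xs"
    then have "vand ys \<in> vands n D" using xs(2) by (auto simp: vands_def)
    then show "vand ys * z \<in> D" using assms(4) by (auto simp: colon_def mult.commute)
  qed (use xs assms in \<open>auto simp: Int_poly_def\<close>)
qed

lemma inv_ideal_vands_mult:
  assumes "d \<in> inv_ideal D (vands (Suc n) D)" "\<delta> \<in> vands n D"
  shows "d * \<delta> \<in> char_ideal n D"
proof -
  obtain xs where xs: "\<delta> = vand xs" "length xs = n" "set xs \<subseteq> D"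
    using assms(2) by (auto simp: vands_def)
  \<comment> \<open>Its value at \<open>x\<close> is \<open>d * vand (x # xs)\<close>, which lies in
    \<open>D\<close> by the choice of \<open>d\<close>, and its coefficient at \<open>n\<close> is
    \<open>d * \<delta>\<close>.\<close>
  define f where "f = smult (d * \<delta>) (linear_prod xs)"
  have "poly f x \<in> D" if "x \<in> D" for x
  proof -
    have "vand (x # xs) \<in> vands (Suc n) D"
      unfolding vands_def using xs that by (intro CollectI exI[of _ "x # xs"]) auto
    then have "d * vand (x # xs) \<in> D" using assms(1) by (auto simp: colon_def)
    then show ?thesis using xs by (simp add: f_def poly_linear_prod ac_simps)
  qed
  then have "f \<in> Int_poly D" by (simp add: Int_poly_def)
  moreover have "degree f \<le> n"
    using degree_linear_prod[of xs] degree_smult_le[of "d * \<delta>" "linear_prod xs"] xs(2)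
    by (simp add: f_def)
  ultimately have "coeff f n \<in> char_ideal n D" by (rule Int_poly_leI)
  then show ?thesis using coeff_linear_prod_length[of xs] xs(2) by (simp add: f_def)
qed

text \<open>The Vandermonde product of \<open>n + 1\<close> distinct points is a nonzero common
  denominator. A finite \<open>D\<close> may lack such points, but it is then a field and equals its
  quotient field.\<close>

lemma nonzero_fractional_char_ideal:
  assumes "domain_with_quotient_field D" shows "nonzero_fractional_ideal D (char_ideal n D)"
proof -
  have "\<exists>a\<in>D. a \<noteq> 0 \<and> (\<forall>x\<in>char_ideal n D. a * x \<in> D)"
  proof (cases "finite D")
    case True
    then show ?thesis using finite_domain_UNIV[OF assms] by (intro bexI[of _ 1]) auto
  next
    case False
    then obtain xs where xs: "length xs = Suc n" "set xs \<subseteq> D" "distinct xs"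
      using exists_distinct_list by blast
    have "vand xs * c \<in> D" if "c \<in> char_ideal n D" for c
    proof -
      obtain f where "f \<in> Int_poly D" "degree f \<le> n" "coeff f n = c" using \<open>c \<in> _\<close> by (rule char_idealE)
      moreover have "vand xs \<in> vands (Suc n) D" using xs by (auto simp: vands_def)
      moreover have "1 \<in> inv_ideal D (vands n D)" using vand_mem by (auto simp: colon_def vands_def)
      ultimately show ?thesis using coeff_vands_mem[of f n "vand xs" 1 n] by (simp add: mult.commute)
    qed
    then show ?thesis using vand_mem[OF xs(2)] xs(3) vand_eq_0_iff by blast
  qed
  then show ?thesis
    using submodule_char_ideal subset_char_ideal[of n] one_mem
    unfolding nonzero_fractional_ideal_def by (metis singletonD subsetD zero_neq_one)
qed

lemma fact_ideal_nonzero: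
  assumes "domain_with_quotient_field D" shows "\<exists>a\<in>fact_ideal n D. a \<noteq> 0"
  using nonzero_fractional_char_ideal[OF assms, of n]
  by (auto simp: nonzero_fractional_ideal_def fact_ideal_def colon_def)

lemma fact_ideal_v_ideal:
  assumes "domain_with_quotient_field D" shows "star_ideal v_op D (fact_ideal n D)"
proof -
  have "submodule D (fact_ideal n D)"
    unfolding fact_ideal_def by (intro submodule_colon submodule_self)
  moreover have "fact_ideal n D \<noteq> {0}" using fact_ideal_nonzero[OF assms, of n] by blast
  moreover have "\<forall>x\<in>fact_ideal n D. 1 * x \<in> D" using fact_ideal_subset by auto
  ultimately have "nonzero_fractional_ideal D (fact_ideal n D)"
    unfolding nonzero_fractional_ideal_def using one_mem zero_neq_one by metis
  then show ?thesis by (simp add: star_ideal_def fact_ideal_def v_op_inv_ideal)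
qed

text \<open>If \<open>{d. d x \<in> I\<^sub>n}\<close> lay in a prime ideal \<open>P\<close>, then \<open>P\<close> would contain a set with trivial
  inverse, hence not be t-maximal, so that \<open>I\<^sub>n\<close> would be trivial at \<open>P\<close>.\<close>

lemma char_ideal_gv_closed:
  assumes "domain_with_quotient_field D" "gv_set D F" "\<And>b. b \<in> F \<Longrightarrow> x * b \<in> char_ideal n D"
  shows "x \<in> char_ideal n D"
proof (rule ccontr)
  assume x: "x \<notin> char_ideal n D"
  define I where "I = {d. x * d \<in> char_ideal n D} \<inter> D"
  have "submodule D I"
    using submodule_vimage_mult[OF submodule_char_ideal[of n], of x] submodule_self
    unfolding I_def submodule_def by blast
  moreover have "I \<subseteq> D" "1 \<notin> I" using x by (auto simp: I_def)
  ultimately obtain P where P: "prime_ideal D P" "I \<subseteq> P" by (rule exists_prime_ideal)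
  interpret localized_at_prime D P by standard (rule P(1))
  have "F \<subseteq> P" using P(2) assms(2,3) by (auto simp: I_def gv_set_def)
  then have "\<not> t_maximal D P" using t_maximal_no_gv_set assms(2) by blast
  then have triv: "Int_poly DP = polys_over DP" using Int_poly_trivial[OF assms(1)] by blast
  have "char_ideal n D \<subseteq> char_ideal n DP"
    using Int_poly_subset_localize by (auto simp: char_ideal_def Int_poly_le_def)
  then have "char_ideal n D \<subseteq> DP" unfolding char_ideal_trivial[OF triv] .
  then have "x \<in> DP" using gv_set_localize[OF assms(2)] assms(3) by blast
  then obtain s where s: "s \<in> D - P" "s * x \<in> D" using loc_iff by blast
  \<comment> \<open>The characteristic ideal contains \<open>D\<close>, so a denominator
    \<open>s\<close> of \<open>x\<close> belongs to \<open>I\<close>, hence to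
    \<open>P\<close>.\<close>
  then have "s \<in> I" using subset_char_ideal[of n] by (auto simp: I_def mult.commute)
  then show False using s(1) P(2) by blast
qed

text \<open>An ideal \<open>J\<close> with t-closure \<open>D\<close> contains a
  \<open>gv_set\<close>, so closedness under such sets bounds the w-closure; the other inclusion
  takes \<open>J = D\<close>.\<close>

lemma char_ideal_w_ideal:
  assumes "domain_with_quotient_field D" shows "star_ideal w_op D (char_ideal n D)"
proof -
  have "w_op D (char_ideal n D) \<subseteq> char_ideal n D"
  proof
    fix x assume "x \<in> w_op D (char_ideal n D)"
    then obtain J where J: "ideal_of D J" "t_op D J = D" "x \<in> colon (char_ideal n D) J"
      by (auto simp: w_op_def)
    then obtain F where "F \<subseteq> J" "gv_set D F" using t_op_eq_iff by (auto simp: ideal_of_def)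
    moreover have "\<forall>b\<in>J. x * b \<in> char_ideal n D" using J(3) by (simp add: colon_def)
    ultimately show "x \<in> char_ideal n D" using char_ideal_gv_closed[OF assms] by blast
  qed
  moreover have "char_ideal n D \<subseteq> w_op D (char_ideal n D)"
  proof -
    have "{1} \<subseteq> D \<and> gv_set D {1}" by (auto simp: gv_set_def)
    then have "\<exists>F\<subseteq>D. gv_set D F" by (rule exI)
    then have "t_op D D = D" by (simp add: t_op_eq_iff[OF submodule_self])
    moreover have "ideal_of D D" "D \<noteq> {0}" using submodule_self one_mem
      by (auto simp: ideal_of_def simp del: one_mem)
    moreover have "char_ideal n D \<subseteq> colon (char_ideal n D) D"
    proof
      fix x assume "x \<in> char_ideal n D"
      then have "\<forall>y\<in>D. y * x \<in> char_ideal n D"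
        using submodule_char_ideal[of n] by (simp add: submodule_def)
      then show "x \<in> colon (char_ideal n D) D" by (simp add: colon_def mult.commute)
    qed
    ultimately show ?thesis unfolding w_op_def by blast
  qed
  ultimately show ?thesis using nonzero_fractional_char_ideal[OF assms] by (auto simp: star_ideal_def)
qed

text \<open>If \<open>x\<close> is in the v-closure of \<open>I_n\<close>, then
  \<open>x I_n^-1 \<subseteq> D\<close>, so \<open>x\<close> multiplies \<open>I_n I_n^-1\<close>
  into \<open>I_n\<close>. That product contains a \<open>gv_set\<close>, under which
  \<open>I_n\<close> is closed.\<close>

lemma t_invertible_char_ideal_v_op:
  assumes "domain_with_quotient_field D" "t_invertible D (char_ideal n D)"
  shows "v_op D (char_ideal n D) = char_ideal n D"
proof
  show "v_op D (char_ideal n D) \<subseteq> char_ideal n D"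
  proof
    fix x assume x: "x \<in> v_op D (char_ideal n D)"
    obtain F where F: "F \<subseteq> ideal_prod D (char_ideal n D) (inv_ideal D (char_ideal n D))" "gv_set D F"
      using t_invertible_gv_set[OF assms(2)] .
    have "ideal_prod D (char_ideal n D) (inv_ideal D (char_ideal n D)) \<subseteq> {z. x * z \<in> char_ideal n D}"
    proof (rule ideal_prod_subset[OF submodule_vimage_mult[OF submodule_char_ideal]])
      fix a b assume ab: "a \<in> char_ideal n D" "b \<in> inv_ideal D (char_ideal n D)"
      then have "x * b \<in> D" using x by (auto simp: v_op_def colon_def)
      then have "(x * b) * a \<in> char_ideal n D" using ab submodule_char_ideal by (auto simp: submodule_def)
      then show "a * b \<in> {z. x * z \<in> char_ideal n D}" by (simp add: ac_simps)
    qed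
    then show "x \<in> char_ideal n D" using char_ideal_gv_closed[OF assms(1) F(2)] F(1) by blast
  qed
qed (rule subset_v_op)

text \<open>Inductive step: the two Vandermonde estimates give
  \<open>I_n V_n^-1 \<subseteq> V_(n+1)^-1\<close> and
  \<open>V_(n+1)^-1 V_n \<subseteq> I_n\<close>. If \<open>y\<close> multiplies
  \<open>V_(n+1) V_(n+1)^-1\<close> into \<open>D\<close>, they show that \<open>y\<close>
  multiplies \<open>I_n I_n^-1 V_n V_n^-1\<close> into \<open>D\<close>, and both pairs are
  cancelled by v-invertibility.\<close>

lemma v_invertible_vands:
  assumes "\<And>k. k < n \<Longrightarrow> t_invertible D (char_ideal k D)"
  shows "v_invertible D (vands n D)"
  using assms
proof (induction n)
  case 0
  have "vands 0 D = {1}" by (auto simp: vands_def)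
  then have "1 \<in> vands 0 D" "1 \<in> inv_ideal D (vands 0 D)" by (auto simp: colon_def)
  then show ?case unfolding v_invertible_def by (metis mult_1_right)
next
  case (Suc n)
  have vn: "v_invertible D (vands n D)" and vc: "v_invertible D (char_ideal n D)"
    using Suc t_invertible_imp_v_invertible by auto
  show ?case unfolding v_invertible_def
  proof (intro allI impI)
    fix y assume y: "\<forall>a\<in>vands (Suc n) D. \<forall>b\<in>inv_ideal D (vands (Suc n) D). y * (a * b) \<in> D"
    show "y \<in> D"
    proof (rule v_invertibleD[OF vc])
      fix c e assume c: "c \<in> char_ideal n D" and e: "e \<in> inv_ideal D (char_ideal n D)"
      show "y * (c * e) \<in> D"
      proof (rule v_invertibleD[OF vn])
        fix \<delta> z assume d: "\<delta> \<in> vands n D" and z: "z \<in> inv_ideal D (vands n D)"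
        obtain f where f: "f \<in> Int_poly D" "degree f \<le> n" "coeff f n = c" using c by (rule char_idealE)
        have "c * z \<in> inv_ideal D (vands (Suc n) D)"
          using coeff_vands_mem[OF f(1,2) _ z, of _ n] f(3) by (auto simp: colon_def ac_simps)
        \<comment> \<open>By its choice, \<open>y\<close> maps the inverse of \<open>V_(n+1)\<close>
          into itself.\<close>
        then have "y * (c * z) \<in> inv_ideal D (vands (Suc n) D)"
        proof -
          have "y * (c * z) * a \<in> D" if a: "a \<in> vands (Suc n) D" for a
          proof -
            have "y * (a * (c * z)) \<in> D" using y a \<open>c * z \<in> _\<close> by blast
            then show ?thesis by (simp add: ac_simps)
          qed
          then show ?thesis by (simp add: colon_def)
        qed
        then have "y * (c * z) * \<delta> \<in> char_ideal n D" using d by (rule inv_ideal_vands_mult)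
        then have "e * (y * (c * z) * \<delta>) \<in> D" using e by (auto simp: colon_def)
        then show "y * (c * e) * (\<delta> * z) \<in> D" by (simp add: ac_simps)
      qed
    qed
  qed
qed

text \<open>From \<open>V_(n+1)^-1 V_n \<subseteq> I_n\<close> follows
  \<open>I_n^-1 V_(n+1)^-1 \<subseteq> V_n^-1\<close>, so a coefficient times \<open>I_n^-1\<close>
  multiplies \<open>V_(n+1) V_(n+1)^-1\<close> into \<open>D\<close>. Cancelling that product places
  the coefficient in the v-closure of \<open>I_n\<close>.\<close>

lemma coeff_Int_poly_mem_char_ideal:
  assumes "domain_with_quotient_field D" "\<And>k. k \<le> n \<Longrightarrow> t_invertible D (char_ideal k D)"
    and f: "f \<in> Int_poly D" "degree f \<le> n"
  shows "coeff f i \<in> char_ideal n D"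
proof -
  have v: "v_invertible D (vands (Suc n) D)" using assms(2) by (intro v_invertible_vands) simp
  have "coeff f i * e \<in> D" if e: "e \<in> inv_ideal D (char_ideal n D)" for e
  proof (rule v_invertibleD[OF v])
    fix \<delta> d assume d: "\<delta> \<in> vands (Suc n) D" "d \<in> inv_ideal D (vands (Suc n) D)"
    have "e * d \<in> inv_ideal D (vands n D)"
      using inv_ideal_vands_mult[OF d(2)] e by (auto simp: colon_def mult.assoc)
    then have "coeff f i * \<delta> * (e * d) \<in> D" using coeff_vands_mem f d(1) by blast
    then show "coeff f i * e * (\<delta> * d) \<in> D" by (simp add: ac_simps)
  qed
  then have "coeff f i \<in> v_op D (char_ideal n D)" by (auto simp: v_op_def colon_def)
  then show ?thesis using t_invertible_char_ideal_v_op[OF assms(1)] assms(2) by blast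
qed

text \<open>All coefficients lie in \<open>I_n\<close>, so an element of its inverse clears them
  all; conversely, the coefficients at \<open>n\<close> alone already define the factorial
  ideal.\<close>

lemma fact_ideal_eq_conductor:
  assumes "domain_with_quotient_field D" "\<And>k. k \<le> n \<Longrightarrow> t_invertible D (char_ideal k D)"
  shows "fact_ideal n D = conductor D (polys_over D) (Int_poly_le n D)"
proof
  show "fact_ideal n D \<subseteq> conductor D (polys_over D) (Int_poly_le n D)"
    using coeff_Int_poly_mem_char_ideal[OF assms(1) assms(2), of n] fact_ideal_subset[of n]
      fact_ideal_mult[of _ n]
    by (auto simp: conductor_def polys_over_def Int_poly_le_def)
  show "conductor D (polys_over D) (Int_poly_le n D) \<subseteq> fact_ideal n D"
    by (auto simp: conductor_def polys_over_def fact_ideal_def colon_def char_ideal_def)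
qed

section \<open>Factorial ideals of sums\<close>

lemma fact_ideal_add_mult:
  assumes "x \<in> fact_ideal (k + l) D" "c \<in> char_ideal k D" "d \<in> char_ideal l D"
  shows "x * (c * d) \<in> D"
  using fact_ideal_mult[OF assms(1)] char_ideal_mult[OF assms(2,3)] by blast

text \<open>The inverses of the factorial ideals are the v-closures of the characteristic ideals.
  Starting from \<open>x I_k I_l \<subseteq> D\<close>, the factors are replaced by their v-closures
  one at a time.\<close>

lemma fact_ideal_add_subset:
  "fact_ideal (k + l) D \<subseteq>
    inv_ideal D (ideal_prod D (inv_ideal D (fact_ideal k D)) (inv_ideal D (fact_ideal l D)))"
proof
  fix x assume x: "x \<in> fact_ideal (k + l) D"
  have "x * (y * z) \<in> D"
    if y: "y \<in> inv_ideal D (fact_ideal k D)" and z: "z \<in> inv_ideal D (fact_ideal l D)" for y z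
  proof -
    have "x * z \<in> fact_ideal k D"
      unfolding fact_ideal_def colon_def
    proof (intro CollectI ballI)
      fix c assume c: "c \<in> char_ideal k D"
      have "x * c \<in> fact_ideal l D"
        using fact_ideal_add_mult[OF x c] by (auto simp: fact_ideal_def colon_def mult.assoc)
      then have "z * (x * c) \<in> D" using z by (auto simp: colon_def)
      then show "x * z * c \<in> D" by (simp add: ac_simps)
    qed
    then have "y * (x * z) \<in> D" using y by (auto simp: colon_def)
    then show ?thesis by (simp add: ac_simps)
  qed
  then have "x \<in> inv_ideal D {y * z | y z. y \<in> inv_ideal D (fact_ideal k D) \<and> z \<in> inv_ideal D (fact_ideal l D)}"
    by (auto simp: colon_def)
  then show "x \<in> inv_ideal D (ideal_prod D (inv_ideal D (fact_ideal k D)) (inv_ideal D (fact_ideal l D)))"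
    unfolding ideal_prod_def colon_hull[OF submodule_self] .
qed

text \<open>For sets \<open>F\<close> and \<open>G\<close> with trivial inverse in
  \<open>I_k k!\<close> and \<open>I_l l!\<close>, the set \<open>x F G\<close> lies in
  \<open>k! l!\<close> because \<open>x I_k I_l \<subseteq> D\<close>. Its v-closure contains
  \<open>x\<close>.\<close>

lemma fact_ideal_add_subset_t_op:
  assumes "domain_with_quotient_field D"
    and k: "t_invertible D (char_ideal k D)" and l: "t_invertible D (char_ideal l D)"
  shows "fact_ideal (k + l) D \<subseteq> t_op D (ideal_prod D (fact_ideal k D) (fact_ideal l D))"
proof
  fix x assume x: "x \<in> fact_ideal (k + l) D"
  define M where "M = ideal_prod D (fact_ideal k D) (fact_ideal l D)"
  have M: "submodule D M" unfolding M_def by (rule submodule_ideal_prod)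
  obtain F where F: "F \<subseteq> ideal_prod D (char_ideal k D) (fact_ideal k D)" "gv_set D F"
    unfolding fact_ideal_def using t_invertible_gv_set[OF k] .
  obtain G where G: "G \<subseteq> ideal_prod D (char_ideal l D) (fact_ideal l D)" "gv_set D G"
    unfolding fact_ideal_def using t_invertible_gv_set[OF l] .
  show "x \<in> t_op D M"
  \<comment> \<open>For \<open>x = 0\<close> the set \<open>H\<close> below would have no nonzero
    element, which the t-operation demands.\<close>
  proof (cases "x = 0")
    case True
    obtain a b where "a \<in> fact_ideal k D" "a \<noteq> 0" "b \<in> fact_ideal l D" "b \<noteq> 0"
      using fact_ideal_nonzero[OF assms(1)] by metis
    then have "a * b \<in> M" "a * b \<noteq> 0" unfolding M_def by (auto intro: ideal_prod_mem)
    then have "M \<noteq> {0}" by blast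
    then have "M \<subseteq> t_op D M" by (rule subset_t_op[OF M])
    then show ?thesis using True M by (auto simp: submodule_def)
  next
    case False
    define H where "H = (\<lambda>(a, b). x * a * b) ` (F \<times> G)"
    have "x * a * b \<in> M" if ab: "a \<in> F" "b \<in> G" for a b
    proof -
      have "x * b * a \<in> M" if a: "a \<in> ideal_prod D (char_ideal k D) (fact_ideal k D)" for a
      proof -
        have "ideal_prod D (char_ideal k D) (fact_ideal k D) \<subseteq> {z. x * b * z \<in> M}"
        proof (rule ideal_prod_subset[OF submodule_vimage_mult[OF M]])
          fix c d assume c: "c \<in> char_ideal k D" "d \<in> fact_ideal k D"
          have "ideal_prod D (char_ideal l D) (fact_ideal l D) \<subseteq> {z. x * (c * d) * z \<in> M}"
          proof (rule ideal_prod_subset[OF submodule_vimage_mult[OF M]])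
            fix c' d' assume c': "c' \<in> char_ideal l D" "d' \<in> fact_ideal l D"
            have "x * (c * c') \<in> D" by (rule fact_ideal_add_mult[OF x c(1) c'(1)])
            moreover have "d * d' \<in> M" unfolding M_def by (rule ideal_prod_mem[OF c(2) c'(2)])
            ultimately have "x * (c * c') * (d * d') \<in> M" using M by (auto simp: submodule_def)
            then show "c' * d' \<in> {z. x * (c * d) * z \<in> M}" by (simp add: ac_simps)
          qed
          then have "x * (c * d) * b \<in> M" using ab(2) G(1) by blast
          then show "c * d \<in> {z. x * b * z \<in> M}" by (simp add: ac_simps)
        qed
        then show ?thesis using a by blast
      qed
      then have "x * b * a \<in> M" using ab(1) F(1) by blast
      then show ?thesis by (simp add: ac_simps)
    qed
    then have "H \<subseteq> M" by (auto simp: H_def)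
    moreover have "finite H" using F(2) G(2) by (auto simp: H_def gv_set_def)
    moreover have "\<exists>h\<in>H. h \<noteq> 0" using F(2) G(2) False unfolding H_def gv_set_def by force
    \<comment> \<open>A multiplier \<open>y\<close> of \<open>x F G\<close> is reduced to
      \<open>x * y \<in> D\<close> by cancelling first \<open>G\<close>, then
      \<open>F\<close>.\<close>
    moreover have "x \<in> v_op D H"
      unfolding mem_v_op_iff
    proof (intro allI impI)
      fix y assume y: "\<forall>h\<in>H. y * h \<in> D"
      have "x * y * a \<in> D" if a: "a \<in> F" for a
      proof -
        have "x * y * a * b \<in> D" if "b \<in> G" for b
          using y a that by (force simp: H_def ac_simps)
        then show ?thesis using G(2) by (auto simp: gv_set_def)
      qed
      then show "x * y \<in> D" using F(2) by (auto simp: gv_set_def)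
    qed
    ultimately show ?thesis unfolding t_op_iff[OF M] by blast
  qed
qed

section \<open>Regular bases\<close>

lemma Int_poly_add: "f \<in> Int_poly D \<Longrightarrow> g \<in> Int_poly D \<Longrightarrow> f + g \<in> Int_poly D"
  and Int_poly_diff: "f \<in> Int_poly D \<Longrightarrow> g \<in> Int_poly D \<Longrightarrow> f - g \<in> Int_poly D"
  and Int_poly_smult: "r \<in> D \<Longrightarrow> f \<in> Int_poly D \<Longrightarrow> smult r f \<in> Int_poly D"
  by (auto simp: Int_poly_def intro: add_mem diff_mem mult_mem)

lemma Int_poly_sum:
  "(\<And>b. b \<in> F \<Longrightarrow> h b \<in> Int_poly D) \<Longrightarrow> sum h F \<in> Int_poly D"
  by (induction F rule: infinite_finite_induct) (simp_all add: Int_poly_add, simp_all add: Int_poly_def)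

text \<open>For each \<open>n\<close> a polynomial is chosen whose leading coefficient generates
  \<open>I_n\<close>. Successive elimination of leading coefficients gives spanning, distinct
  degrees give independence.\<close>

lemma has_regular_basis_if_principal:
  assumes "\<And>n. is_principal D (char_ideal n D)"
  shows "has_regular_basis D"
proof -
  have "\<exists>g. g \<in> Int_poly D \<and> degree g = n \<and> (\<forall>c\<in>char_ideal n D. \<exists>r\<in>D. c = r * coeff g n) \<and> g \<noteq> 0" for n
  proof -
    obtain a where a: "char_ideal n D = {r * a | r. r \<in> D}" using assms[of n] by (auto simp: is_principal_def)
    have "1 * a \<in> char_ideal n D" unfolding a using one_mem by blast
    then obtain g where g: "g \<in> Int_poly D" "degree g \<le> n" "coeff g n = 1 * a" by (rule char_idealE)
    \<comment> \<open>The generator is nonzero because \<open>I_n\<close> contains 1; this makes the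
      degree of \<open>g\<close> exactly \<open>n\<close>.\<close>
    have "a \<noteq> 0"
    proof
      assume "a = 0"
      then have "1 \<notin> char_ideal n D" unfolding a by auto
      then show False using subset_char_ideal[of n] one_mem by blast
    qed
    then have "degree g = n" using g le_degree[of g n] by auto
    then show ?thesis using g a \<open>a \<noteq> 0\<close> by (intro exI[of _ g]) auto
  qed
  then have "\<exists>g. \<forall>n. g n \<in> Int_poly D \<and> degree (g n) = n \<and>
      (\<forall>c\<in>char_ideal n D. \<exists>r\<in>D. c = r * coeff (g n) n) \<and> g n \<noteq> 0"
    by (intro choice) blast
  then obtain g where g: "\<And>n. g n \<in> Int_poly D" "\<And>n. degree (g n) = n"
    "\<And>n c. c \<in> char_ideal n D \<Longrightarrow> \<exists>r\<in>D. c = r * coeff (g n) n" "\<And>n. g n \<noteq> 0"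
    by blast
  have "inj g" by (rule inj_on_inverseI[of _ degree]) (rule g(2))
  define B where "B = range g"
  have deg_inj: "b = b'" if "b \<in> B" "b' \<in> B" "degree b = degree b'" for b b'
    using that by (auto simp: B_def g(2))
  have span: "\<exists>F c. f = (\<Sum>b\<in>F. smult (c b) b) \<and> finite F \<and> F \<subseteq> B \<and> c ` F \<subseteq> D"
    if f: "f \<in> Int_poly D" for f
  proof -
    \<comment> \<open>The alternative \<open>f = 0\<close> makes the bound meaningful for
      \<open>n = 0\<close>, where the sum is empty.\<close>
    have "\<exists>c. range c \<subseteq> D \<and> f = (\<Sum>k<n. smult (c k) (g k))" if "f \<in> Int_poly D" "f = 0 \<or> degree f < n" for n f
      using that
    proof (induction n arbitrary: f)
      case 0
      then show ?case by (auto intro!: exI[of _ "\<lambda>_. 0"])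
    next
      case (Suc n)
      have "degree f \<le> n" using Suc.prems(2) by auto
      then have "coeff f n \<in> char_ideal n D" using Int_poly_leI[OF Suc.prems(1)] by blast
      then obtain r where r: "r \<in> D" "coeff f n = r * coeff (g n) n" using g(3) by blast
      define h where "h = f - smult r (g n)"
      have "h \<in> Int_poly D" unfolding h_def by (intro Int_poly_diff Int_poly_smult Suc.prems r g)
      moreover have "degree h \<le> n" unfolding h_def
        using \<open>degree f \<le> n\<close> g(2) by (intro degree_diff_le) (auto intro: order_trans[OF degree_smult_le])
      moreover have "coeff h n = 0" using r by (simp add: h_def)
      ultimately obtain c where c: "range c \<subseteq> D" "h = (\<Sum>k<n. smult (c k) (g k))"
        using Suc.IH[of h] eq_zero_or_degree_less by blast
      have "f = (\<Sum>k<Suc n. smult ((c(n := r)) k) (g k))"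
        using c(2) by (simp add: h_def algebra_simps)
      then show ?case using c(1) r(1) by (intro exI[of _ "c(n := r)"]) auto
    qed
    then obtain c where c: "range c \<subseteq> D" "f = (\<Sum>k<Suc (degree f). smult (c k) (g k))"
      using f by blast
    have "inj_on g {..<Suc (degree f)}" using \<open>inj g\<close> by (rule inj_on_subset) simp
    \<comment> \<open>A basis element is identified by its degree, which turns coefficients indexed
      by numbers into coefficients indexed by polynomials.\<close>
    then have "(\<Sum>b\<in>g ` {..<Suc (degree f)}. smult (c (degree b)) b)
        = (\<Sum>k<Suc (degree f). smult (c k) (g k))"
      by (simp add: sum.reindex g(2) del: sum.lessThan_Suc)
    then have "f = (\<Sum>b\<in>g ` {..<Suc (degree f)}. smult (c (degree b)) b)"
      using c(2) by simp
    then show ?thesis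
      using c(1) by (intro exI[of _ "g ` {..<Suc (degree f)}"] exI[of _ "\<lambda>b. c (degree b)"])
        (auto simp: B_def)
  qed
  have indep: "\<forall>b\<in>F. c b = 0"
    if F: "finite F" "F \<subseteq> B" "(\<Sum>b\<in>F. smult (c b) b) = 0" for F c
  proof (rule ccontr)
    assume nz: "\<not> (\<forall>b\<in>F. c b = 0)"
    define F' where "F' = {b \<in> F. c b \<noteq> 0}"
    have F': "finite (degree ` F')" "degree ` F' \<noteq> {}"
      using F(1) nz by (auto simp: F'_def)
    obtain b where b: "b \<in> F'" "degree b = Max (degree ` F')" using Max_in[OF F'] by auto
    \<comment> \<open>Among the terms with nonzero coefficient \<open>b\<close> has the largest
      degree, and no other term shares it, so only \<open>b\<close> contributes in that
      degree.\<close>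
    have "coeff (smult (c b') b') (degree b) = (if b' = b then c b * lead_coeff b else 0)" if b': "b' \<in> F" for b'
    proof (cases "b' = b \<or> c b' = 0")
      case False
      then have "degree b' \<le> degree b" using b b' F'(1) by (auto simp: F'_def)
      moreover have "degree b' \<noteq> degree b" using deg_inj[of b' b] b b' F(2) False by (auto simp: F'_def)
      ultimately show ?thesis using False by (simp add: coeff_eq_0)
    qed auto
    then have "(\<Sum>b'\<in>F. coeff (smult (c b') b') (degree b))
        = (\<Sum>b'\<in>F. if b' = b then c b * lead_coeff b else 0)"
      by (rule sum.cong[OF refl])
    moreover have "\<dots> = c b * lead_coeff b" using F(1) b(1) by (simp add: F'_def)
    moreover have "(\<Sum>b'\<in>F. coeff (smult (c b') b') (degree b)) = 0"
      using F(3) by (simp only: coeff_0 flip: coeff_sum)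
    moreover have "b \<noteq> 0" using b(1) F(2) g(4) by (auto simp: F'_def B_def)
    ultimately show False using b(1) by (auto simp: F'_def)
  qed
  have "module_basis D (Int_poly D) B"
    unfolding module_basis_def
  proof
    show "Int_poly D = {\<Sum>b\<in>F. smult (c b) b |F c. finite F \<and> F \<subseteq> B \<and> c ` F \<subseteq> D}"
    proof (intro equalityI subsetI)
      fix f assume "f \<in> {\<Sum>b\<in>F. smult (c b) b |F c. finite F \<and> F \<subseteq> B \<and> c ` F \<subseteq> D}"
      then obtain F c where "f = (\<Sum>b\<in>F. smult (c b) b)" "F \<subseteq> B" "c ` F \<subseteq> D" by blast
      then show "f \<in> Int_poly D"
        using g(1) by (auto simp: B_def intro!: Int_poly_sum Int_poly_smult)
    next
      fix f assume "f \<in> Int_poly D"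
      then show "f \<in> {\<Sum>b\<in>F. smult (c b) b |F c. finite F \<and> F \<subseteq> B \<and> c ` F \<subseteq> D}"
        by (intro CollectI span)
    qed
    show "\<forall>F c. finite F \<and> F \<subseteq> B \<and> c ` F \<subseteq> D \<and> (\<Sum>b\<in>F. smult (c b) b) = 0 \<longrightarrow> (\<forall>b\<in>F. c b = 0)"
    proof (intro allI impI)
      fix F c assume "finite F \<and> F \<subseteq> B \<and> c ` F \<subseteq> D \<and> (\<Sum>b\<in>F. smult (c b) b) = 0"
      then show "\<forall>b\<in>F. c b = 0" by (intro indep) auto
    qed
  qed
  moreover have "\<exists>!f. f \<in> B \<and> degree f = n" for n
    using g(2) by (intro ex1I[of _ "g n"]) (auto simp: B_def)
  ultimately show ?thesis unfolding has_regular_basis_def by blast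
qed

end

section \<open>Characteristic and factorial ideals after localization at a prime\<close>

context localized_at_prime
begin

text \<open>The ideal \<open>I_n n!\<close> contains a \<open>gv_set\<close>, which no t-maximal
  ideal contains, so one of the generating products is a unit at \<open>P\<close>.\<close>

lemma t_maximal_unit_pair:
  assumes "t_maximal D P" "t_invertible D (char_ideal n D)"
  obtains c e where "c \<in> char_ideal n D" "e \<in> fact_ideal n D" "c * e \<in> D - P"
proof -
  obtain F where F: "F \<subseteq> ideal_prod D (char_ideal n D) (fact_ideal n D)" "gv_set D F"
    unfolding fact_ideal_def using t_invertible_gv_set[OF assms(2)] .
  have "\<exists>c\<in>char_ideal n D. \<exists>e\<in>fact_ideal n D. c * e \<notin> P"
  proof (rule ccontr)
    assume "\<not> ?thesis"
    then have "ideal_prod D (char_ideal n D) (fact_ideal n D) \<subseteq> P"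
      by (intro ideal_prod_subset[OF submodule_P]) blast
    then show False using t_maximal_no_gv_set[OF assms(1) F(2)] F(1) by blast
  qed
  then show ?thesis using that fact_ideal_mult by (metis DiffI mult.commute)
qed

lemma localize_fact_ideal:
  assumes "t_maximal D P" "t_invertible D (char_ideal n D)"
    and loc: "localize (D - P) (char_ideal n D) = char_ideal n DP"
  shows "ideal_prod DP (fact_ideal n D) DP = fact_ideal n DP"
proof
  have "submodule DP (fact_ideal n DP)"
    unfolding fact_ideal_def by (intro L.submodule_colon L.submodule_self)
  then show "ideal_prod DP (fact_ideal n D) DP \<subseteq> fact_ideal n DP"
  proof (rule L.ideal_prod_subset)
    fix e r assume e: "e \<in> fact_ideal n D" and r: "r \<in> DP"
    have "e * r * c \<in> DP" if c: "c \<in> char_ideal n DP" for c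
    proof -
      obtain s where s: "s \<in> D - P" "s * c \<in> char_ideal n D"
        using c unfolding loc[symmetric] loc_iff by blast
      then have "e * (s * c) \<in> DP" using fact_ideal_mult[OF e] loc_subset by blast
      then have "r * (e * (s * c)) \<in> DP" using r L.mult_mem by blast
      then have "s * (e * r * c) \<in> DP" by (simp add: ac_simps)
      then show ?thesis using cancel_S s(1) by blast
    qed
    then show "e * r \<in> fact_ideal n DP" by (auto simp: fact_ideal_def colon_def)
  qed
  show "fact_ideal n DP \<subseteq> ideal_prod DP (fact_ideal n D) DP"
  proof
    fix x assume x: "x \<in> fact_ideal n DP"
    obtain c e where ce: "c \<in> char_ideal n D" "e \<in> fact_ideal n D" "c * e \<in> D - P"
      using t_maximal_unit_pair[OF assms(1,2)] .
    have "c \<in> char_ideal n DP" using ce(1) loc loc_subset by blast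
    \<comment> \<open>This writes \<open>x\<close> as \<open>e\<close> times
      \<open>x * c / (c * e)\<close>, where \<open>x * c\<close> is in \<open>DP\<close> and
      \<open>c * e\<close> is a unit there.\<close>
    then have "x * c * inverse (c * e) \<in> DP"
      by (intro L.mult_mem L.fact_ideal_mult[OF x] inverse_S ce(3))
    then have "e * (x * c * inverse (c * e)) \<in> ideal_prod DP (fact_ideal n D) DP"
      by (rule L.ideal_prod_mem[OF ce(2)])
    moreover have "c * e \<noteq> 0" using ce(3) zero_P by auto
    then have "e * (x * c * inverse (c * e)) = x" by (simp add: field_simps)
    ultimately show "x \<in> ideal_prod DP (fact_ideal n D) DP" by (simp only:)
  qed
qed

text \<open>At a t-maximal \<open>P\<close> the element \<open>c\<close> of the unit pair is a
  generator, since \<open>e * y \<in> DP\<close> for every \<open>y\<close> in the localized ideal.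
  At other primes the ideal is \<open>DP\<close> itself.\<close>

lemma principal_char_ideal:
  assumes "domain_with_quotient_field D" "t_invertible D (char_ideal n D)"
    and loc: "localize (D - P) (char_ideal n D) = char_ideal n DP"
  shows "is_principal DP (char_ideal n DP)"
proof (cases "t_maximal D P")
  case True
  obtain c e where ce: "c \<in> char_ideal n D" "e \<in> fact_ideal n D" "c * e \<in> D - P"
    using t_maximal_unit_pair[OF True assms(2)] .
  have ne: "c * e \<noteq> 0" using ce(3) zero_P by auto
  have cL: "c \<in> char_ideal n DP" using ce(1) loc loc_subset by blast
  have "char_ideal n DP = {r * c | r. r \<in> DP}"
  proof (intro equalityI subsetI)
    fix y assume "y \<in> char_ideal n DP"
    then obtain s where s: "s \<in> D - P" "s * y \<in> char_ideal n D"
      unfolding loc[symmetric] loc_iff by blast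
    then have "e * (s * y) \<in> DP" using fact_ideal_mult[OF ce(2)] loc_subset by blast
    then have "s * (e * y) \<in> DP" by (simp add: ac_simps)
    then have "e * y \<in> DP" by (rule cancel_S[OF s(1)])
    then have "e * y * inverse (c * e) \<in> DP" by (rule L.mult_mem[OF _ inverse_S[OF ce(3)]])
    moreover have "y = e * y * inverse (c * e) * c" using ne by (simp add: field_simps)
    ultimately show "y \<in> {r * c | r. r \<in> DP}" by blast
  next
    fix y assume "y \<in> {r * c | r. r \<in> DP}"
    then show "y \<in> char_ideal n DP" using cL L.submodule_char_ideal by (auto simp: submodule_def)
  qed
  then show ?thesis by (auto simp: is_principal_def)
next
  case False
  then have "char_ideal n DP = DP" using Int_poly_trivial[OF assms(1)] char_ideal_trivial by blast
  then show ?thesis unfolding is_principal_def by (intro exI[of _ 1]) auto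
qed

end

lemma (in subring_set) L_regular_localize_char_ideal:
  assumes "polynomially_L_regular D" "mult_subset D S"
  shows "localize S (char_ideal n D) = char_ideal n (localize S D)"
proof -
  interpret localized D S by standard (rule assms(2))
  show ?thesis using assms by (intro localize_char_ideal) (simp add: polynomially_L_regular_def)
qed

theorem theorem3p4:
  fixes D :: "'k::field set"
  assumes "domain_with_quotient_field D"
  shows
    "(\<comment> \<open>(1)\<close>
        D = char_ideal 0 D \<and> char_ideal 0 D = char_ideal 1 D \<and>
        (\<forall>n. char_ideal n D \<subseteq> char_ideal (Suc n) D) \<and>
        (\<forall>k l. ideal_prod D (char_ideal k D) (char_ideal l D) \<subseteq> char_ideal (k + l) D)) \<and>
     (\<comment> \<open>(2)\<close>
        D = fact_ideal 0 D \<and> fact_ideal 0 D = fact_ideal 1 D \<and>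
        (\<forall>n. fact_ideal (Suc n) D \<subseteq> fact_ideal n D) \<and>
        (\<forall>k l. fact_ideal (k + l) D \<subseteq>
           inv_ideal D (ideal_prod D (inv_ideal D (fact_ideal k D)) (inv_ideal D (fact_ideal l D))))) \<and>
     (\<comment> \<open>(3)\<close>
        \<forall>S. mult_subset D S \<longrightarrow>
          (localize_poly S (Int_poly D) = Int_poly (localize S D) \<longleftrightarrow>
             (\<forall>n. localize S (char_ideal n D) = char_ideal n (localize S D)))) \<and>
     (\<comment> \<open>(4)\<close>
        \<forall>P. prime_ideal D P \<and> \<not> (t_maximal D P \<and> finite_norm D P) \<longrightarrow>
          localize_poly (D - P) (Int_poly D) = Int_poly (localize (D - P) D) \<and>
          Int_poly (localize (D - P) D) = polys_over (localize (D - P) D) \<and>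
          (\<forall>n. localize (D - P) (char_ideal n D) = char_ideal n (localize (D - P) D) \<and>
               char_ideal n (localize (D - P) D) = localize (D - P) D)) \<and>
     (\<comment> \<open>(5)\<close>
        \<forall>n. star_ideal w_op D (char_ideal n D) \<and> star_ideal v_op D (fact_ideal n D)) \<and>
     (\<comment> \<open>(6)\<close>
        \<forall>n. t_invertible D (char_ideal n D) \<longrightarrow>
          star_ideal v_op D (char_ideal n D) \<and>
          char_ideal n D = inv_ideal D (fact_ideal n D)) \<and>
     (\<comment> \<open>(7)\<close>
        \<forall>n. (\<forall>k\<le>n. t_invertible D (char_ideal k D)) \<longrightarrow>
          (\<forall>f\<in>Int_poly_le n D. \<forall>i. coeff f i \<in> char_ideal n D) \<and>
          fact_ideal n D = conductor D (polys_over D) (Int_poly_le n D) \<and>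
          (\<forall>k\<le>n. \<forall>l\<le>n. fact_ideal (k + l) D \<subseteq>
             t_op D (ideal_prod D (fact_ideal k D) (fact_ideal l D)))) \<and>
     (\<comment> \<open>(8)\<close>
        polynomially_L_regular D \<longrightarrow>
          (\<forall>n S. mult_subset D S \<longrightarrow>
             localize S (char_ideal n D) = char_ideal n (localize S D)) \<and>
          (\<forall>n. t_invertible D (char_ideal n D) \<longrightarrow>
             (\<forall>P. t_maximal D P \<longrightarrow>
                ideal_prod (localize (D - P) D) (fact_ideal n D) (localize (D - P) D) =
                fact_ideal n (localize (D - P) D)) \<and>
             (\<forall>P. prime_ideal D P \<longrightarrow>
                is_principal (localize (D - P) D) (char_ideal n (localize (D - P) D)))) \<and>
          ((\<forall>n. t_invertible D (char_ideal n D)) \<longrightarrow>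
             (\<forall>P. prime_ideal D P \<longrightarrow> has_regular_basis (localize (D - P) D)) \<and>
             locally_free D (Int_poly D)))"
proof -
  interpret subring_set D
    by standard (use assms in \<open>simp add: domain_with_quotient_field_def\<close>)
  have "ideal_prod D (char_ideal k D) (char_ideal l D) \<subseteq> char_ideal (k + l) D" for k l
    by (rule ideal_prod_subset[OF submodule_char_ideal char_ideal_mult])
  then have 1: "D = char_ideal 0 D \<and> char_ideal 0 D = char_ideal 1 D \<and>
      (\<forall>n. char_ideal n D \<subseteq> char_ideal (Suc n) D) \<and>
      (\<forall>k l. ideal_prod D (char_ideal k D) (char_ideal l D) \<subseteq> char_ideal (k + l) D)"
    using char_ideal_0 char_ideal_1 char_ideal_Suc by auto

  have 2: "D = fact_ideal 0 D \<and> fact_ideal 0 D = fact_ideal 1 D \<and>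
      (\<forall>n. fact_ideal (Suc n) D \<subseteq> fact_ideal n D) \<and>
      (\<forall>k l. fact_ideal (k + l) D \<subseteq>
         inv_ideal D (ideal_prod D (inv_ideal D (fact_ideal k D)) (inv_ideal D (fact_ideal l D))))"
  proof (intro conjI allI)
    show "D = fact_ideal 0 D" "fact_ideal 0 D = fact_ideal 1 D"
      unfolding fact_ideal_def char_ideal_0 char_ideal_1 inv_ideal_self by auto
  qed (rule fact_ideal_antimono fact_ideal_add_subset; simp)+

  have 3: "\<forall>S. mult_subset D S \<longrightarrow>
      (localize_poly S (Int_poly D) = Int_poly (localize S D) \<longleftrightarrow>
         (\<forall>n. localize S (char_ideal n D) = char_ideal n (localize S D)))"
  proof (intro allI impI)
    fix S assume "mult_subset D S"
    then interpret localized D S by unfold_locales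
    show "localize_poly S (Int_poly D) = Int_poly (localize S D) \<longleftrightarrow>
        (\<forall>n. localize S (char_ideal n D) = char_ideal n (localize S D))"
      using localize_char_ideal localize_Int_poly by blast
  qed

  have 4: "\<forall>P. prime_ideal D P \<and> \<not> (t_maximal D P \<and> finite_norm D P) \<longrightarrow>
      localize_poly (D - P) (Int_poly D) = Int_poly (localize (D - P) D) \<and>
      Int_poly (localize (D - P) D) = polys_over (localize (D - P) D) \<and>
      (\<forall>n. localize (D - P) (char_ideal n D) = char_ideal n (localize (D - P) D) \<and>
           char_ideal n (localize (D - P) D) = localize (D - P) D)"
  proof (intro allI impI)
    fix P assume P: "prime_ideal D P \<and> \<not> (t_maximal D P \<and> finite_norm D P)"
    then interpret localized_at_prime D P by unfold_locales blast
    have triv: "Int_poly DP = polys_over DP" using Int_poly_trivial assms P by blast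
    \<comment> \<open>The localization of \<open>Int_poly D\<close> lies between
      \<open>polys_over DP\<close> and \<open>Int_poly DP\<close>, which coincide.\<close>
    then have eq: "localize_poly (D - P) (Int_poly D) = Int_poly DP"
      using loc_Int_poly_subset polys_over_subset_localize by blast
    have "char_ideal n DP = DP" for n by (rule char_ideal_trivial[OF triv])
    then show "localize_poly (D - P) (Int_poly D) = Int_poly DP \<and> Int_poly DP = polys_over DP \<and>
      (\<forall>n. localize (D - P) (char_ideal n D) = char_ideal n DP \<and> char_ideal n DP = DP)"
      using eq triv localize_char_ideal[OF eq] by blast
  qed

  have 5: "\<forall>n. star_ideal w_op D (char_ideal n D) \<and> star_ideal v_op D (fact_ideal n D)"
    using char_ideal_w_ideal fact_ideal_v_ideal assms by blast

  have 6: "\<forall>n. t_invertible D (char_ideal n D) \<longrightarrow>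
      star_ideal v_op D (char_ideal n D) \<and> char_ideal n D = inv_ideal D (fact_ideal n D)"
    using t_invertible_char_ideal_v_op[OF assms] nonzero_fractional_char_ideal[OF assms]
    by (auto simp: star_ideal_def fact_ideal_def v_op_def)

  have 7: "\<forall>n. (\<forall>k\<le>n. t_invertible D (char_ideal k D)) \<longrightarrow>
      (\<forall>f\<in>Int_poly_le n D. \<forall>i. coeff f i \<in> char_ideal n D) \<and>
      fact_ideal n D = conductor D (polys_over D) (Int_poly_le n D) \<and>
      (\<forall>k\<le>n. \<forall>l\<le>n. fact_ideal (k + l) D \<subseteq>
         t_op D (ideal_prod D (fact_ideal k D) (fact_ideal l D)))"
  proof (intro allI impI conjI ballI)
    fix n assume inv: "\<forall>k\<le>n. t_invertible D (char_ideal k D)"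
    show "coeff f i \<in> char_ideal n D" if "f \<in> Int_poly_le n D" for f i
      using coeff_Int_poly_mem_char_ideal[OF assms, of n f i] inv that by (simp add: Int_poly_le_def)
    show "fact_ideal n D = conductor D (polys_over D) (Int_poly_le n D)"
      using fact_ideal_eq_conductor[OF assms] inv by blast
    show "fact_ideal (k + l) D \<subseteq> t_op D (ideal_prod D (fact_ideal k D) (fact_ideal l D))"
      if "k \<le> n" "l \<le> n" for k l
      using fact_ideal_add_subset_t_op[OF assms] inv that by blast
  qed

  have 8: "(\<forall>n S. mult_subset D S \<longrightarrow>
         localize S (char_ideal n D) = char_ideal n (localize S D)) \<and>
      (\<forall>n. t_invertible D (char_ideal n D) \<longrightarrow>
         (\<forall>P. t_maximal D P \<longrightarrow>
            ideal_prod (localize (D - P) D) (fact_ideal n D) (localize (D - P) D) =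
            fact_ideal n (localize (D - P) D)) \<and>
         (\<forall>P. prime_ideal D P \<longrightarrow>
            is_principal (localize (D - P) D) (char_ideal n (localize (D - P) D)))) \<and>
      ((\<forall>n. t_invertible D (char_ideal n D)) \<longrightarrow>
         (\<forall>P. prime_ideal D P \<longrightarrow> has_regular_basis (localize (D - P) D)) \<and>
         locally_free D (Int_poly D))"
    if reg: "polynomially_L_regular D"
  proof -
    note loc = L_regular_localize_char_ideal[OF reg]
    have fact: "ideal_prod (localize (D - P) D) (fact_ideal n D) (localize (D - P) D) =
        fact_ideal n (localize (D - P) D)"
      if "t_invertible D (char_ideal n D)" "t_maximal D P" for n P
    proof -
      interpret localized_at_prime D P by unfold_locales (rule t_maximal_prime[OF that(2)])
      show ?thesis by (rule localize_fact_ideal[OF that(2,1) loc[OF mult_subset]])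
    qed
    have princ: "is_principal (localize (D - P) D) (char_ideal n (localize (D - P) D))"
      if "t_invertible D (char_ideal n D)" "prime_ideal D P" for n P
    proof -
      interpret localized_at_prime D P by unfold_locales (rule that(2))
      show ?thesis by (rule principal_char_ideal[OF assms that(1) loc[OF mult_subset]])
    qed
    have basis: "has_regular_basis (localize (D - P) D)"
      if "\<forall>n. t_invertible D (char_ideal n D)" "prime_ideal D P" for P
    proof -
      interpret localized_at_prime D P by unfold_locales (rule that(2))
      show ?thesis using princ that by (intro L.has_regular_basis_if_principal) blast
    qed
    have "locally_free D (Int_poly D)" if "\<forall>n. t_invertible D (char_ideal n D)"
      unfolding locally_free_def
    proof (intro allI impI)
      fix P assume P: "prime_ideal D P"
      \<comment> \<open>L-regularity identifies the localized module with the integer-valued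
        polynomials over the localization, and a regular basis of these is in particular a
        basis.\<close>
      have "localize_poly (D - P) (Int_poly D) = Int_poly (localize (D - P) D)"
        using reg prime_mult_subset[OF P] by (simp add: polynomially_L_regular_def)
      then show "free_module (localize (D - P) D) (localize_poly (D - P) (Int_poly D))"
        using basis[OF that P] by (auto simp: free_module_def has_regular_basis_def)
    qed
    then show ?thesis using loc fact princ basis by blast
  qed
  show ?thesis
    by (rule conjI[OF 1 conjI[OF 2 conjI[OF 3 conjI[OF 4 conjI[OF 5 conjI[OF 6 conjI[OF 7 impI[OF 8]]]]]]]])
qed

end
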